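(* Let $k\ge 1$ be an integer. The insertion map $d\mapsto (P_\lambda,Q_\lambda)$ defined in the context is a bijection $$A_k\ \longrightarrow\ \bigsqcup_{\lambda\in\Gamma_k}\mathrm{VT}_k(\lambda)\times\mathrm{VT}_k(\lambda).$$ Consequently $$B(2k)=\sum_{\lambda\in\Gamma_k}(m_k^\lambda)^2,$$ where $B(2k)$ is the number of set partitions of a set with $2k$ elements and $m_k^\lambda=|\mathrm{VT}_k(\lambda)|$.
   Context: $A_k$ is the set of set partitions of $\{1,\ldots,k,1',\ldots,k'\}$. Integer partitions are identified with Young diagrams (English convention), and $\Gamma_i$ is the set of all integer partitions $\lambda$ with $0\le|\lambda|\le i$. A vacillating tableau of shape $\lambda\in\Gamma_k$ and length $2k$ is a sequence of partitions $(\emptyset=\lambda^{(0)},\lambda^{(1/2)},\lambda^{(1)},\ldots,\lambda^{(k-1/2)},\lambda^{(k)}=\lambda)$ such that for each integer $0\le i\le k-1$: $\lambda^{(i+1/2)}$ equals $\lambda^{(i)}$ or is obtained from it by removing one box; and $\lambda^{(i+1)}$ equals $\lambda^{(i+1/2)}$ or is obtained from it by adding one box (so $\lambda^{(i)},\lambda^{(i+1/2)}\in\Gamma_i$). $\mathrm{VT}_k(\lambda)$ is the set of these. Standard representation of $d\in A_k$: relabel the vertex $j'$ as $2k-j+1$, so that $d$ becomes a set partition of $\{1,\ldots,2k\}$, drawn with vertices in a row. Connect $i<j$ by an edge if and only if $i,j$ are in the same block and no $m$ with $i<m<j$ is in that block. Label each edge by $2k+1-\ell$, where $\ell$ is its right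 (larger) endpoint. Each vertex is the left endpoint of at most one edge and the right endpoint of at most one edge. Insertion sequence of $d$: $E=(E_{1/2},E_1,E_{3/2},\ldots,E_{2k-1/2},E_{2k})$, where for each integer $1\le j\le 2k$: $E_j=a$ if vertex $j$ is the left endpoint of the edge labeled $a$, and $E_j=\emptyset$ if $j$ is not a left endpoint; $E_{j-1/2}=a$ if vertex $j$ is the right endpoint of the edge labeled $a$, and $E_{j-1/2}=\emptyset$ if $j$ is not a right endpoint. A "tableau" is a filling of a Young diagram by distinct positive integers increasing along rows and down columns. Jeu de taquin deletion of an entry $x$: while the box of $x$ is not a corner (end of both its row and column), exchange $x$ with the smaller of the entries immediately below and immediately to the right (or the only one that exists); then delete the corner containing $x$. RSK row insertion of $x$: let $R$ be the first row; while $x$ is less than some element of $R$, replace the smallest element $y>x$ of $R$ by $x$, set $x:=y$, and let $R$ be the next row; finally place $x$ at the end of $R$. Insertion map: let $T^{(0)}=\emptyset$. For $0\le j\le 2k-1$, $T^{(j+1/2)}$ is $T^{(j)}$ with $E_{j+1/2}$ deleted by jeu de taquin if $E_{j+1/2}\ne\emptyset$, and $T^{(j+1/2)}=T^{(j)}$ otherwise; $T^{(j+1)}$ is $T^{(j+1/2)}$ with $E_{j+1}$ row-inserted if $E_{j+1}\neq\emptyset$, and $T^{(j+1)}=T^{(j+1/2)}$ otherwise. Let $\lambda^{(i)}$ be the shape of $T^{(i)}$ for all $i\in\{0,\frac12,1,\ldots,2k\}$, and $\lambda=\lambda^{(k)}$. Then $Q_\lambda=(\lambda^{(0)},\lambda^{(1/2)},\ldots,\lambda^{(k-1/2)},\lambda^{(k)})$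 and $P_\lambda=(\lambda^{(2k)},\lambda^{(2k-1/2)},\ldots,\lambda^{(k+1/2)},\lambda^{(k)})$. One writes $d\to(P_\lambda,Q_\lambda)$. *)

theory Defs
  imports Main "HOL-Library.Disjoint_Sets"
begin

datatype vertex = Top nat | Bot nat  \<comment> \<open>\<open>Top j\<close> is $j$ and \<open>Bot j\<close> is $j'$\<close>

definition set_partitions :: "'a set \<Rightarrow> 'a set set set" where
  "set_partitions S = {d. partition_on S d}"

definition A :: "nat \<Rightarrow> vertex set set set" where
  "A k = set_partitions (Top ` {1..k} \<union> Bot ` {1..k})"

definition bell :: "nat \<Rightarrow> nat" where
  "bell n = card (set_partitions {1..n})"

text \<open>Boxes are (row, column) pairs counted from 0, row 0 being on top.\<close>

type_synonym box = "nat \<times> nat"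

definition is_int_partition :: "nat list \<Rightarrow> bool" where
  "is_int_partition \<mu> \<longleftrightarrow> sorted_wrt (\<ge>) \<mu> \<and> 0 \<notin> set \<mu>"

definition diagram :: "nat list \<Rightarrow> box set" where
  "diagram \<mu> = {(r, c). r < length \<mu> \<and> c < \<mu> ! r}"

definition Gamma :: "nat \<Rightarrow> nat list set" where
  "Gamma i = {\<mu>. is_int_partition \<mu> \<and> sum_list \<mu> \<le> i}"

definition adds_box :: "nat list \<Rightarrow> nat list \<Rightarrow> bool" where
  "adds_box \<mu> \<nu> \<longleftrightarrow> (\<exists>b. b \<notin> diagram \<mu> \<and> diagram \<nu> = insert b (diagram \<mu>))"

text \<open>Half-integer positions are doubled throughout: the object written with index
  $i \in \{0, \frac12, 1, \dots\}$ on paper has index $2i$ here. In particular a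
  vacillating tableau of length $2k$ is a list of $2k+1$ partitions.\<close>

definition VT :: "nat \<Rightarrow> nat list \<Rightarrow> nat list list set" where
  "VT k \<mu> = {v. length v = 2 * k + 1 \<and> (\<forall>\<nu> \<in> set v. is_int_partition \<nu>) \<and>
     v ! 0 = [] \<and> v ! (2 * k) = \<mu> \<and>
     (\<forall>i < k.
        (v ! (2 * i + 1) = v ! (2 * i) \<or> adds_box (v ! (2 * i + 1)) (v ! (2 * i))) \<and>
        (v ! (2 * i + 2) = v ! (2 * i + 1) \<or> adds_box (v ! (2 * i + 1)) (v ! (2 * i + 2))))}"

fun std_vertex :: "nat \<Rightarrow> vertex \<Rightarrow> nat" where
  "std_vertex k (Top j) = j"
| "std_vertex k (Bot j) = 2 * k - j + 1"

definition std_rep :: "nat \<Rightarrow> vertex set set \<Rightarrow> nat set set" where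
  "std_rep k d = (\<lambda>B. std_vertex k ` B) ` d"

definition edges :: "nat set set \<Rightarrow> (nat \<times> nat) set" where
  "edges D = {(i, j). i < j \<and> (\<exists>B \<in> D. i \<in> B \<and> j \<in> B \<and> (\<forall>m. i < m \<and> m < j \<longrightarrow> m \<notin> B))}"

definition edge_label :: "nat \<Rightarrow> nat \<times> nat \<Rightarrow> nat" where
  "edge_label k e = 2 * k + 1 - snd e"

definition left_label :: "nat \<Rightarrow> vertex set set \<Rightarrow> nat \<Rightarrow> nat option" where
  "left_label k d j =
     (if \<exists>e \<in> edges (std_rep k d). fst e = j
      then Some (edge_label k (THE e. e \<in> edges (std_rep k d) \<and> fst e = j)) else None)"

definition right_label :: "nat \<Rightarrow> vertex set set \<Rightarrow> nat \<Rightarrow> nat option" where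
  "right_label k d j =
     (if \<exists>e \<in> edges (std_rep k d). snd e = j
      then Some (edge_label k (THE e. e \<in> edges (std_rep k d) \<and> snd e = j)) else None)"

text \<open>Even index $2j$ stands for $E_j$, odd index $2j-1$ for $E_{j-1/2}$.\<close>

definition insertion_seq :: "nat \<Rightarrow> vertex set set \<Rightarrow> nat \<Rightarrow> nat option" where
  "insertion_seq k d n =
     (if even n then left_label k d (n div 2) else right_label k d ((n + 1) div 2))"

text \<open>A tableau is the list of its rows, without empty rows.\<close>

type_synonym tableau = "nat list list"

definition shape :: "tableau \<Rightarrow> nat list" where
  "shape T = map length T"

fun entry :: "tableau \<Rightarrow> box \<Rightarrow> nat option" where
  "entry T (r, c) = (if r < length T \<and> c < length (T ! r) then Some (T ! r ! c) else None)"

fun set_entry :: "tableau \<Rightarrow> box \<Rightarrow> nat \<Rightarrow> tableau" where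
  "set_entry T (r, c) x = T[r := (T ! r)[c := x]]"

definition exchange :: "tableau \<Rightarrow> box \<Rightarrow> box \<Rightarrow> tableau" where
  "exchange T p q = set_entry (set_entry T p (the (entry T q))) q (the (entry T p))"

fun smaller_neighbour :: "tableau \<Rightarrow> box \<Rightarrow> box option" where
  "smaller_neighbour T (r, c) =
     (case (entry T (Suc r, c), entry T (r, Suc c)) of
        (None, None) \<Rightarrow> None
      | (Some y, None) \<Rightarrow> Some (Suc r, c)
      | (None, Some z) \<Rightarrow> Some (r, Suc c)
      | (Some y, Some z) \<Rightarrow> Some (if y < z then (Suc r, c) else (r, Suc c)))"

fun remove_corner :: "tableau \<Rightarrow> box \<Rightarrow> tableau" where
  "remove_corner T (r, c) = filter (\<lambda>R. R \<noteq> []) (T[r := butlast (T ! r)])"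

lemma smaller_neighbour_SomeD:
  assumes "smaller_neighbour T (r, c) = Some q"
  shows "q = (Suc r, c) \<and> Suc r < length T \<or> q = (r, Suc c) \<and> r < length T \<and> Suc c < length (T ! r)"
  using assms by (auto split: option.splits if_splits)

lemma length_exchange: "length (exchange T p q) = length T"
  by (cases p; cases q) (simp add: exchange_def)

lemma length_exchange_nth: "r < length T \<Longrightarrow> length (exchange T p q ! r) = length (T ! r)"
  by (cases p; cases q) (auto simp: exchange_def nth_list_update)

function jdt_slide :: "tableau \<Rightarrow> box \<Rightarrow> tableau" where
  "jdt_slide T p =
     (case smaller_neighbour T p of
        None \<Rightarrow> remove_corner T p
      | Some q \<Rightarrow> jdt_slide (exchange T p q) q)"
  by auto
termination
proof (relation "measures [\<lambda>(T, p). length T - fst p, \<lambda>(T, p). length (T ! fst p) - snd p]", goal_cases)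
  case 1
  show ?case by simp
next
  case (2 T p q)
  then show ?case
    using smaller_neighbour_SomeD[of T "fst p" "snd p" q]
    by (auto simp: length_exchange length_exchange_nth)
qed

definition jdt_delete :: "nat \<Rightarrow> tableau \<Rightarrow> tableau" where
  "jdt_delete x T = jdt_slide T (THE p. entry T p = Some x)"

fun row_insert :: "nat \<Rightarrow> tableau \<Rightarrow> tableau" where
  "row_insert x [] = [[x]]"
| "row_insert x (R # Rs) =
     (if \<exists>y \<in> set R. x < y
      then let y = Min {y \<in> set R. x < y}
           in map (\<lambda>z. if z = y then x else z) R # row_insert y Rs
      else (R @ [x]) # Rs)"

fun insertion_tableau :: "nat \<Rightarrow> vertex set set \<Rightarrow> nat \<Rightarrow> tableau" where
  "insertion_tableau k d 0 = []"
| "insertion_tableau k d (Suc n) =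
     (case insertion_seq k d (Suc n) of
        None \<Rightarrow> insertion_tableau k d n
      | Some a \<Rightarrow> (if even n then jdt_delete a (insertion_tableau k d n)
                  else row_insert a (insertion_tableau k d n)))"

definition insertion_shape :: "nat \<Rightarrow> vertex set set \<Rightarrow> nat \<Rightarrow> nat list" where
  "insertion_shape k d n = shape (insertion_tableau k d n)"

definition Q_tab :: "nat \<Rightarrow> vertex set set \<Rightarrow> nat list list" where
  "Q_tab k d = map (insertion_shape k d) [0..<2 * k + 1]"

definition P_tab :: "nat \<Rightarrow> vertex set set \<Rightarrow> nat list list" where
  "P_tab k d = map (insertion_shape k d) (rev [2 * k..<4 * k + 1])"

text \<open>The first component records the summand of the disjoint union.\<close>

definition insertion_map ::
  "nat \<Rightarrow> vertex set set \<Rightarrow> nat list \<times> nat list list \<times> nat list list" where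
  "insertion_map k d = (insertion_shape k d (2 * k), P_tab k d, Q_tab k d)"

end

theory Submission
  imports Defs "HOL-Library.Multiset"
begin

text \<open>An arc ending at vertex \<open>j\<close> carries the label \<open>2k + 1 - j\<close>, so at every moment the label to be
  deleted next is the largest entry of the tableau. It sits in a corner, and the jeu de taquin
  merely removes that corner. Both kinds of steps can therefore be undone from the shapes alone:
  a deletion by writing the known largest entry into the box that reappears, an insertion by
  reverse row bumping from the box that disappears. Running the \<open>4k\<close> steps backwards from the empty
  tableau recovers all labels and thus the arcs of the set partition, whichever sequence of shapes
  one starts from; splitting the sequence in the middle gives the pair of vacillating tableaux.\<close>

section \<open>Tableaux and their shapes\<close>

text \<open>Arcs open after vertex \<open>i\<close> end beyond \<open>i\<close>, so their labels are
  at most \<open>N - i\<close> with \<open>N = 2 * k\<close>; this is why the label of an arc ending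
  at \<open>Suc i\<close> is the maximum when it leaves.

  Surjectivity is the harder half: only shapes are given, no set partition. Running backwards, the
  value \<open>N - i\<close> is written whenever a box reappears, so it is automatically new and
  maximal. As the tableau is empty at both ends of the run, each entry that enters is also bumped
  out, and pairing the two moments yields arcs in which no vertex is used twice on the same side. To
  compare the rebuilt tableaux with those of the algorithm, both are instances of one locale,
  \<open>arc_run\<close>, in which the arcs determine the tableaux. Set partitions enter only
  through \<open>edges\<close>, a bijection onto arc diagrams.

  The cut in the middle works because a deletion followed by an insertion, read backwards, again
  removes at most one box and then adds at most one.\<close>

definition entries :: "tableau \<Rightarrow> nat set" where
  "entries T = set (concat T)"

text \<open>Column strictness as a relation between whole rows; its length condition makes the shape
  weakly decreasing.\<close>

definition below :: "nat list \<Rightarrow> nat list \<Rightarrow> bool" where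
  "below R S \<longleftrightarrow> length S \<le> length R \<and> (\<forall>c < length S. R ! c < S ! c)"

definition is_tableau :: "tableau \<Rightarrow> bool" where
  "is_tableau T \<longleftrightarrow>
     (\<forall>R \<in> set T. R \<noteq> [] \<and> sorted_wrt (<) R) \<and> sorted_wrt below T \<and> distinct (concat T)"

lemma entries_simps [simp]:
  "entries [] = {}" "entries (R # T) = set R \<union> entries T"
  by (auto simp: entries_def)

lemma transp_below: "transp below"
  unfolding below_def by (rule transpI) (meson less_trans order.trans less_le_trans)

lemma is_tableau_Nil [simp]: "is_tableau []"
  by (simp add: is_tableau_def)

lemma distinct_if_strictly_sorted: "sorted_wrt (<) R \<Longrightarrow> distinct (R :: nat list)"
  by (simp add: strict_sorted_iff)

text \<open>Later inductions peel off the first row; by transitivity of \<open>below\<close> only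
  the next row has to be compared with it.\<close>

lemma is_tableau_Cons:
  "is_tableau (R # T) \<longleftrightarrow>
     R \<noteq> [] \<and> sorted_wrt (<) R \<and> (T \<noteq> [] \<longrightarrow> below R (hd T)) \<and> set R \<inter> entries T = {} \<and> is_tableau T"
proof -
  have "sorted_wrt below (R # T) \<longleftrightarrow> (T \<noteq> [] \<longrightarrow> below R (hd T)) \<and> sorted_wrt below T"
    using transpD[OF transp_below] by (cases T) auto
  then show ?thesis
    by (auto simp: is_tableau_def entries_def distinct_if_strictly_sorted simp del: sorted_wrt.simps)
qed

lemma is_int_partition_shape:
  assumes "is_tableau T"
  shows "is_int_partition (shape T)"
proof -
  have "sorted_wrt (\<lambda>R S. length S \<le> length R) T"
    using assms by (auto simp: is_tableau_def below_def intro: sorted_wrt_mono_rel[of _ below])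
  then show ?thesis
    using assms by (auto simp: is_int_partition_def shape_def sorted_wrt_map is_tableau_def)
qed

lemma is_int_partition_Cons:
  "is_int_partition (a # \<mu>) \<longleftrightarrow> 0 < a \<and> (\<mu> \<noteq> [] \<longrightarrow> hd \<mu> \<le> a) \<and> is_int_partition \<mu>"
  unfolding is_int_partition_def by (cases \<mu>) auto

lemma sum_list_shape:
  assumes "is_tableau T"
  shows "sum_list (shape T) = card (entries T)"
proof -
  have "sum_list (shape T) = length (concat T)"
    by (simp add: length_concat shape_def)
  then show ?thesis
    using assms by (simp add: is_tableau_def entries_def distinct_card del: set_concat)
qed

text \<open>\<open>adds_box\<close> compares sets of boxes; this relation expresses the same by
  recursion on rows, parallel to the recursion of \<open>row_insert\<close>. Being a partition is
  assumed separately.\<close>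

inductive grows :: "nat list \<Rightarrow> nat list \<Rightarrow> bool" where
  new_row: "grows [] [1]"
| here: "grows (a # \<mu>) (Suc a # \<mu>)"
| later: "grows \<mu> \<nu> \<Longrightarrow> grows (a # \<mu>) (a # \<nu>)"

section \<open>Diagrams and the addition of one box\<close>

lemma diagram_Nil [simp]: "diagram [] = {}"
  by (simp add: diagram_def)

lemma diagram_Cons: "diagram (a # \<mu>) = Pair 0 ` {..<a} \<union> apfst Suc ` diagram \<mu>"
  by (auto simp: diagram_def image_iff nth_Cons split: nat.splits)

lemma mem_diagram_Cons [simp]:
  "(0, c) \<in> diagram (a # \<mu>) \<longleftrightarrow> c < a" "(Suc r, c) \<in> diagram (a # \<mu>) \<longleftrightarrow> (r, c) \<in> diagram \<mu>"
  by (auto simp: diagram_def)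

lemma diagram_eq_empty_iff:
  assumes "0 \<notin> set \<mu>"
  shows "diagram \<mu> = {} \<longleftrightarrow> \<mu> = []"
proof (cases \<mu>)
  case (Cons a \<mu>')
  then have "(0, 0) \<in> diagram \<mu>"
    using assms by simp
  then show ?thesis
    using Cons by blast
qed simp

text \<open>Zero parts occupy no boxes, so the diagram determines the list only in their
  absence.\<close>

lemma diagram_inj:
  assumes "0 \<notin> set \<mu>" "0 \<notin> set \<nu>" "diagram \<mu> = diagram \<nu>"
  shows "\<mu> = \<nu>"
  using assms
proof (induction \<mu> arbitrary: \<nu>)
  case Nil
  then show ?case
    using diagram_eq_empty_iff[of \<nu>] by simp
next
  case (Cons a \<mu>)
  then obtain b \<nu>' where \<nu>: "\<nu> = b # \<nu>'"
    using diagram_eq_empty_iff[of "a # \<mu>"] by (cases \<nu>) auto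
  have eq: "(r, c) \<in> diagram (a # \<mu>) \<longleftrightarrow> (r, c) \<in> diagram (b # \<nu>')" for r c
    using Cons.prems \<nu> by simp
  have "a = b"
    using eq[of 0 a] eq[of 0 b] by auto
  moreover have "diagram \<mu> = diagram \<nu>'"
    using eq[of "Suc _"] by auto
  ultimately show ?case
    using Cons \<nu> by auto
qed

lemma grows_imp_adds_box: "grows \<mu> \<nu> \<Longrightarrow> adds_box \<mu> \<nu>"
proof (induction rule: grows.induct)
  case new_row
  have "diagram [1] = insert (0, 0) (diagram [])"
    by (auto simp: diagram_Cons)
  then show ?case
    unfolding adds_box_def by auto
next
  case (here a \<mu>)
  have "(0, a) \<notin> diagram (a # \<mu>)" "diagram (Suc a # \<mu>) = insert (0, a) (diagram (a # \<mu>))"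
    by (auto simp: diagram_Cons)
  then show ?case
    unfolding adds_box_def by blast
next
  case (later \<mu> \<nu> a)
  then obtain r c where "(r, c) \<notin> diagram \<mu>" "diagram \<nu> = insert (r, c) (diagram \<mu>)"
    by (auto simp: adds_box_def)
  then have "(Suc r, c) \<notin> diagram (a # \<mu>)"
    "diagram (a # \<nu>) = insert (Suc r, c) (diagram (a # \<mu>))"
    by (auto simp: diagram_Cons)
  then show ?case
    unfolding adds_box_def by blast
qed

lemma adds_box_imp_grows:
  assumes "0 \<notin> set \<mu>" "0 \<notin> set \<nu>" "adds_box \<mu> \<nu>"
  shows "grows \<mu> \<nu>"
  using assms
proof (induction \<nu> arbitrary: \<mu>)
  case Nil
  then show ?case
    by (auto simp: adds_box_def)
next
  case (Cons a \<nu>)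
  then obtain r c where new: "(r, c) \<notin> diagram \<mu>"
    and "diagram (a # \<nu>) = insert (r, c) (diagram \<mu>)"
    by (auto simp: adds_box_def)
  then have eq: "(r', c') \<in> diagram (a # \<nu>) \<longleftrightarrow> r' = r \<and> c' = c \<or> (r', c') \<in> diagram \<mu>" for r' c'
    by auto
  show ?case
  proof (cases \<mu>)
    case Nil
    have "r = 0" "c = 0"
      using eq[of 0 0] Nil Cons.prems by auto
    then have "a = 1" "diagram \<nu> = diagram []"
      using eq[of 0 1] eq[of "Suc _"] Nil Cons.prems by auto
    then show ?thesis
      using Nil Cons.prems diagram_inj[of \<nu> "[]"] by (auto intro: new_row[simplified])
  next
    case (Cons b \<mu>')
    show ?thesis
    proof (cases r)
      case 0
      \<comment> \<open>Row 0 of the larger diagram is \<open>{..<b}\<close> together with column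
        \<open>c\<close>, where \<open>c\<close> is not below \<open>b\<close>; testing the boundary
        columns forces \<open>c = b\<close>.\<close>
      have "a = Suc b"
        using eq[of 0 a] eq[of 0 b] eq[of 0 "Suc b"] eq[of 0 c] new Cons 0 by auto
      moreover have "diagram \<nu> = diagram \<mu>'"
        using eq[of "Suc _"] Cons 0 by auto
      ultimately show ?thesis
        using Cons.prems Cons diagram_inj[of \<nu> \<mu>'] by (auto intro: here)
    next
      case (Suc r')
      have "a = b"
        using eq[of 0 a] eq[of 0 b] Cons Suc by auto
      moreover have "adds_box \<mu>' \<nu>"
        using eq[of "Suc _"] new Cons Suc unfolding adds_box_def
        by (intro exI[of _ "(r', c)"]) auto
      ultimately show ?thesis
        using Cons.prems Cons Cons.IH[of \<mu>'] by (auto intro: later)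
    qed
  qed
qed

lemma grows_neq: "grows \<mu> \<nu> \<Longrightarrow> \<mu> \<noteq> \<nu>"
  by (induction rule: grows.induct) auto

section \<open>Row insertion and its inverse\<close>

lemma row_insert_append: "\<forall>z \<in> set R. z < x \<Longrightarrow> row_insert x (R # T) = (R @ [x]) # T"
  by fastforce

lemma row_insert_bump:
  assumes xs: "\<forall>z \<in> set xs. z < x" and "x < y" and ys: "\<forall>z \<in> set ys. y < z"
  shows "row_insert x ((xs @ y # ys) # T) = (xs @ x # ys) # row_insert y T"
proof -
  have "Min {z \<in> set (xs @ y # ys). x < z} = y"
    using assms by (intro Min_eqI) auto
  moreover have "map (\<lambda>z. if z = y then x else z) (xs @ y # ys) = xs @ x # ys"
    using assms by (auto intro!: map_idI)
  ultimately show ?thesis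
    using \<open>x < y\<close> by (auto simp: Let_def simp del: map_append)
qed

text \<open>In an increasing row the smallest larger entry is the first larger one, so the row
  splits around it. The split replaces the recursive equation in the inductions below.\<close>

lemma row_insert_cases:
  assumes "sorted_wrt (<) R" "x \<notin> set R"
  obtains (append) "\<forall>z \<in> set R. z < x" "\<And>T. row_insert x (R # T) = (R @ [x]) # T"
  | (bump) xs y ys where "R = xs @ y # ys" "\<forall>z \<in> set xs. z < x" "x < y" "\<forall>z \<in> set ys. y < z"
      "\<And>T. row_insert x (R # T) = (xs @ x # ys) # row_insert y T"
proof (cases "\<exists>y \<in> set R. x < y")
  case False
  then have "\<forall>z \<in> set R. z < x"
    using assms(2) by (metis linorder_neqE_nat)
  with False show ?thesis
    using append by auto
next
  case True
  then obtain xs y ys where R: "R = xs @ y # ys" "x < y" and "\<forall>z \<in> set xs. \<not> x < z"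
    using split_list_first_prop[of R "\<lambda>y. x < y"] by blast
  then have xs: "\<forall>z \<in> set xs. z < x"
    using assms(2) by (metis UnCI linorder_neqE_nat set_append)
  have ys: "\<forall>z \<in> set ys. y < z" and "\<forall>z \<in> set xs. z < y"
    using assms(1) R by (auto simp: sorted_wrt_append)
  show ?thesis
    using bump[OF R(1) xs R(2) ys] row_insert_bump[OF xs R(2) ys] R(1) by simp
qed

lemma row_insert_not_Nil [simp]: "row_insert x T \<noteq> []"
  by (cases T) (auto simp: Let_def)

declare row_insert.simps(2) [simp del]

section \<open>Effect of row insertion on entries, order and shape\<close>

lemma mset_row_insert:
  assumes "is_tableau T" "x \<notin> entries T"
  shows "mset (concat (row_insert x T)) = add_mset x (mset (concat T))"
  using assms
proof (induction T arbitrary: x)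
  case Nil
  then show ?case by simp
next
  case (Cons R T)
  have "sorted_wrt (<) R" "x \<notin> set R"
    using Cons.prems by (auto simp: is_tableau_Cons)
  then show ?case
  proof (cases rule: row_insert_cases)
    case append
    then show ?thesis by simp
  next
    case (bump xs y ys)
    have "mset (concat (row_insert y T)) = add_mset y (mset (concat T))"
      using Cons bump by (auto simp: is_tableau_Cons)
    with bump show ?thesis
      by simp
  qed
qed

lemma entries_row_insert:
  assumes "is_tableau T" "x \<notin> entries T"
  shows "entries (row_insert x T) = insert x (entries T)"
  using arg_cong[OF mset_row_insert[OF assms], of set_mset] by (simp add: entries_def)

text \<open>Bumping moves weakly to the left: anything under the old \<open>y\<close> in column
  \<open>length xs\<close> is larger than \<open>y\<close>, so entries of \<open>S\<close> less than
  \<open>y\<close> occur only in earlier columns, and \<open>y\<close> lands in a column at most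
  \<open>length xs\<close>. Above it then stands an entry at most \<open>x\<close>, hence less than
  \<open>y\<close>.\<close>

lemma below_bump:
  assumes R: "below (xs @ y # ys) S" and A: "\<forall>z \<in> set xs. z < x" and "x < y"
    and S: "sorted_wrt (<) S" "y \<notin> set S"
  shows "below (xs @ x # ys) (hd (row_insert y (S # T)))"
proof -
  have short: "n \<le> length xs" if "n \<le> length S" "\<forall>z \<in> set (take n S). z < y" for n
  proof (rule ccontr)
    assume *: "\<not> ?thesis"
    then have "y < S ! length xs"
      using R that by (auto simp: below_def dest: spec[of _ "length xs"])
    moreover have "S ! length xs \<in> set (take n S)"
      using * that by (auto simp: in_set_conv_nth intro!: exI[of _ "length xs"])
    ultimately show False
      using that by fastforce
  qed
  have le: "(xs @ x # ys) ! c \<le> (xs @ y # ys) ! c" for c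
    using \<open>x < y\<close> by (simp add: nth_append nth_Cons')
  then have less: "(xs @ x # ys) ! c < S ! c" if "c < length S" for c
    using R that le_less_trans unfolding below_def by blast
  have less_y: "(xs @ x # ys) ! c < y" if "c \<le> length xs" for c
  proof (cases "c = length xs")
    case True
    then show ?thesis using \<open>x < y\<close> by simp
  next
    case False
    then have "xs ! c < x"
      using that A by simp
    then show ?thesis
      using False that \<open>x < y\<close> by (simp add: nth_append)
  qed
  have len: "length S \<le> length (xs @ x # ys)"
    using R by (simp add: below_def)
  from S show ?thesis
  proof (cases rule: row_insert_cases)
    case append
    then have "length S \<le> length xs"
      using short[of "length S"] by simp
    then show ?thesis
      using append less less_y[of "length S"] by (simp add: below_def nth_append less_Suc_eq)
  next
    case (bump xs' z ys')
    have S': "(xs' @ y # ys') ! c = (if c = length xs' then y else S ! c)" for c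
      unfolding bump by (simp add: nth_append nth_Cons')
    have "length xs' \<le> length xs"
      using bump short[of "length xs'"] by fastforce
    then show ?thesis
      using bump(5) less less_y len bump(1) by (simp add: below_def S')
  qed
qed

lemma is_tableau_row_insert:
  assumes "is_tableau T" "x \<notin> entries T"
  shows "is_tableau (row_insert x T)"
  using assms
proof (induction T arbitrary: x)
  case Nil
  then show ?case
    by (simp add: is_tableau_def)
next
  case (Cons R T)
  have R: "sorted_wrt (<) R" "x \<notin> set R" and T: "is_tableau T" "x \<notin> entries T"
    using Cons.prems by (auto simp: is_tableau_Cons)
  from R show ?case
  proof (cases rule: row_insert_cases)
    case append
    have "below (R @ [x]) S" if "below R S" for S
      using that by (auto simp: below_def nth_append)
    with Cons.prems append show ?thesis
      by (auto simp: is_tableau_Cons sorted_wrt_append)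
  next
    case (bump xs y ys)
    have y: "y \<notin> entries T"
      using Cons.prems bump by (auto simp: is_tableau_Cons)
    have "below (xs @ x # ys) (hd (row_insert y T))"
    proof (cases T)
      case Nil
      then show ?thesis
        using bump by (cases xs) (auto simp: below_def)
    next
      case (Cons S T')
      then show ?thesis
        using below_bump[of xs y ys S x T'] bump Cons.prems y by (auto simp: is_tableau_Cons)
    qed
    moreover have "sorted_wrt (<) (xs @ x # ys)"
      using R bump by (fastforce simp: sorted_wrt_append)
    moreover have "set (xs @ x # ys) \<inter> entries (row_insert y T) = {}"
      using Cons.prems bump T y by (auto simp: is_tableau_Cons entries_row_insert)
    ultimately show ?thesis
      using bump Cons.IH[OF T(1) y] by (simp add: is_tableau_Cons)
  qed
qed

lemma shape_row_insert:
  assumes "is_tableau T" "x \<notin> entries T"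
  shows "grows (shape T) (shape (row_insert x T))"
  using assms
proof (induction T arbitrary: x)
  case Nil
  then show ?case
    by (simp add: shape_def new_row[simplified])
next
  case (Cons R T)
  have "sorted_wrt (<) R" "x \<notin> set R"
    using Cons.prems by (auto simp: is_tableau_Cons)
  then show ?case
  proof (cases rule: row_insert_cases)
    case append
    then show ?thesis
      by (simp add: shape_def here)
  next
    case (bump xs y ys)
    then show ?thesis
      using Cons by (auto simp: is_tableau_Cons shape_def intro: later)
  qed
qed

text \<open>Equality of the shapes makes this true: the length of the first row of the result tells
  whether both insertions ended there or both bumped. In the second case induction on the lower rows
  returns the bumped entry.\<close>

lemma row_insert_inj:
  assumes "is_tableau T" "x \<notin> entries T" "is_tableau T'" "x' \<notin> entries T'"
    and "shape T = shape T'" "row_insert x T = row_insert x' T'"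
  shows "x = x' \<and> T = T'"
  using assms
proof (induction T arbitrary: x x' T')
  case Nil
  then show ?case
    by (simp add: shape_def)
next
  case (Cons R T)
  then obtain R' S' where T': "T' = R' # S'" and len: "length R = length R'"
    and shape: "shape T = shape S'"
    by (cases T') (auto simp: shape_def)
  have R: "sorted_wrt (<) R" "x \<notin> set R" and R': "sorted_wrt (<) R'" "x' \<notin> set R'"
    using Cons.prems T' by (auto simp: is_tableau_Cons)
  from R show ?case
  proof (cases rule: row_insert_cases)
    case append
    note x = this
    from R' show ?thesis
      using len Cons.prems(6) T'
      by (cases rule: row_insert_cases) (auto simp: x dest: arg_cong[of _ _ length])
  next
    case (bump xs y ys)
    note x = this
    from R' show ?thesis
    proof (cases rule: row_insert_cases)
      case append
      then show ?thesis
        using len Cons.prems(6) T' x by (auto dest: arg_cong[of _ _ length])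
    next
      case (bump xs' y' ys')
      have row: "xs @ x # ys = xs' @ x' # ys'" and "row_insert y T = row_insert y' S'"
        using Cons.prems(6) T' x bump by auto
      then have *: "y = y' \<and> T = S'"
        using Cons.prems T' x bump shape by (intro Cons.IH) (auto simp: is_tableau_Cons)
      \<comment> \<open>Entries of \<open>ys\<close> exceed \<open>y\<close> while
        \<open>x' < y' = y\<close>, so \<open>x'\<close> lies in \<open>xs\<close> or equals
        \<open>x\<close>, which gives \<open>x' \<le> x\<close>; the converse is symmetric.\<close>
      have "x' \<in> set (xs @ x # ys)" "x \<in> set (xs' @ x' # ys')"
        unfolding row by (simp, simp flip: row)
      then have "x = x'"
        using x bump * by force
      moreover have "x \<notin> set xs" "x \<notin> set ys"
        using x by force+
      then have "xs = xs' \<and> ys = ys'"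
        using row \<open>x = x'\<close> append_Cons_eq_iff[of x xs ys xs' ys'] by simp
      ultimately show ?thesis
        using T' x bump * by simp
    qed
  qed
qed

text \<open>The converse of \<open>below_bump\<close>. Everything in \<open>ys\<close> exceeds
  \<open>y\<close>, so \<open>y\<close> cannot have been placed in a column beyond
  \<open>length xs\<close>; hence in column \<open>length xs\<close> the old \<open>S\<close> held
  nothing or an entry larger than \<open>y\<close>.\<close>

lemma below_unbump:
  assumes R: "below (xs @ x # ys) (hd (row_insert y (S # T)))"
    and ys: "\<forall>z \<in> set ys. y < z" and "x < y"
    and S: "sorted_wrt (<) S" "y \<notin> set S"
  shows "below (xs @ y # ys) S"
  using S
proof (cases rule: row_insert_cases)
  case append
  have "length S \<le> length xs"
  proof (rule ccontr)
    assume *: "\<not> ?thesis"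
    then have "(xs @ x # ys) ! length S < y" "(xs @ x # ys) ! length S \<in> set ys"
      using R append by (auto simp: below_def nth_append nth_Cons' dest: spec[of _ "length S"])
    with ys show False
      by fastforce
  qed
  then show ?thesis
    using R append by (auto simp: below_def nth_append nth_Cons' less_Suc_eq)
next
  case (bump xs' z ys')
  have *: "length xs' \<le> length xs"
  proof (rule ccontr)
    assume *: "\<not> ?thesis"
    then have "(xs @ x # ys) ! length xs' < y" "(xs @ x # ys) ! length xs' \<in> set ys"
      using R bump by (auto simp: below_def nth_append nth_Cons' dest: spec[of _ "length xs'"])
    with ys show False
      by fastforce
  qed
  have len: "length S \<le> length (xs @ y # ys)"
    using R bump by (auto simp: below_def)
  have "(xs @ y # ys) ! c < S ! c" if c: "c < length S" for c
  proof (cases "c = length xs")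
    case True
    then show ?thesis
      using * bump c nth_mem[of "c - Suc (length xs')" ys'] by (fastforce simp: nth_append nth_Cons')
  next
    case False
    then have eq: "(xs @ y # ys) ! c = (xs @ x # ys) ! c"
      by (simp add: nth_append nth_Cons')
    have "(xs @ x # ys) ! c < (xs' @ y # ys') ! c"
      using R bump c by (auto simp: below_def)
    moreover have "(xs' @ y # ys') ! c \<le> S ! c"
      using bump by (simp add: nth_append nth_Cons')
    ultimately show ?thesis
      using eq by simp
  qed
  with len show ?thesis
    by (simp add: below_def)
qed

text \<open>Guarantees that reverse bumping never gets stuck: an entry pushed up from below finds
  something smaller in the row above.\<close>

lemma hd_hd_less_entries:
  assumes "is_tableau (R # T)" "y \<in> entries T"
  shows "hd R < y"
  using assms
proof (induction T arbitrary: R)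
  case Nil
  then show ?case by simp
next
  case (Cons S T)
  have "hd R < hd S"
    using Cons.prems(1) by (auto simp: is_tableau_Cons below_def hd_conv_nth)
  moreover have "hd S \<le> y"
  proof (cases "y \<in> set S")
    case True
    then show ?thesis
      using Cons.prems(1) by (cases S) (auto simp: is_tableau_Cons)
  next
    case False
    then show ?thesis
      using Cons.IH[of S] Cons.prems by (auto simp: is_tableau_Cons)
  qed
  ultimately show ?case
    by simp
qed

text \<open>Reverse row bumping, from the row of the disappearing box up to the first row. That
  \<open>\<mu>\<close> is a partition says that this box is a corner, so the shortened row is still
  long enough for the row below it.\<close>

lemma row_insert_surj:
  assumes "grows \<mu> (shape U)" "is_int_partition \<mu>" "is_tableau U"
  shows "\<exists>x T. is_tableau T \<and> x \<notin> entries T \<and> shape T = \<mu> \<and> row_insert x T = U"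
  using assms
proof (induction \<mu> "shape U" arbitrary: U rule: grows.induct)
  case new_row
  then obtain x where "U = [[x]]"
    by (auto simp: shape_def length_Suc_conv eq_commute[of "[Suc 0]"])
  then show ?case
    by (intro exI[of _ x] exI[of _ "[]"]) (simp add: shape_def)
next
  case (here a \<mu>)
  then obtain R x T where U: "U = (R @ [x]) # T" and "length R = a" "shape T = \<mu>"
    by (cases U; cases "hd U" rule: rev_cases) (auto simp: shape_def)
  moreover have "R \<noteq> []"
    using here \<open>length R = a\<close> by (auto simp: is_int_partition_Cons)
  moreover have "below R (hd T)" if "T \<noteq> []"
  proof -
    have "hd \<mu> = length (hd T)" "\<mu> \<noteq> []"
      using that \<open>shape T = \<mu>\<close> by (auto simp: shape_def hd_map)
    then have "length (hd T) \<le> length R"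
      using here(2) \<open>length R = a\<close> by (simp add: is_int_partition_Cons)
    with here(3) U that show ?thesis
      by (auto simp: is_tableau_Cons below_def nth_append)
  qed
  ultimately have "is_tableau (R # T)" "x \<notin> entries (R # T)" "shape (R # T) = a # \<mu>"
    "row_insert x (R # T) = U"
    using here(3) by (auto simp: is_tableau_Cons sorted_wrt_append shape_def row_insert_append)
  then show ?case
    by blast
next
  case (later \<mu> \<nu> a)
  then obtain R U' where U: "U = R # U'" and R: "length R = a" and "\<nu> = shape U'"
    by (cases U) (auto simp: shape_def)
  then obtain y T where T: "is_tableau T" "y \<notin> entries T" "shape T = \<mu>" and y: "row_insert y T = U'"
    using later.hyps(2)[of U'] later.prems by (auto simp: is_int_partition_Cons is_tableau_Cons)
  have U': "entries U' = insert y (entries T)"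
    using entries_row_insert T y by blast
  then have "hd R < y" "R \<noteq> []" and yR: "y \<notin> set R"
    using hd_hd_less_entries[of R U' y] later.prems U by (auto simp: is_tableau_Cons)
  then have "\<exists>x \<in> set R. x < y"
    by auto
  \<comment> \<open>Insertion displaces the first larger entry, so its inverse displaces the last
    smaller one.\<close>
  then obtain xs x ys where AB: "R = xs @ x # ys" "x < y" and "\<forall>z \<in> set ys. \<not> z < y"
    using split_list_last_prop[of R "\<lambda>x. x < y"] by blast
  then have ys: "\<forall>z \<in> set ys. y < z"
    using yR by (metis UnCI linorder_neqE_nat set_append list.set_intros(2))
  have xs: "\<forall>z \<in> set xs. z < x" and sR: "sorted_wrt (<) R" and disj: "set R \<inter> entries U' = {}"
    using later.prems U AB by (auto simp: is_tableau_Cons sorted_wrt_append)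
  have "below (xs @ y # ys) (hd T)" if nonempty: "T \<noteq> []"
  proof -
    obtain S T' where "T = S # T'"
      using nonempty by (cases T) auto
    moreover have "below R (hd U')"
      using later.prems U y row_insert_not_Nil[of y T] by (auto simp: is_tableau_Cons)
    ultimately show ?thesis
      using below_unbump[of xs x ys y S T'] AB ys y T by (auto simp: is_tableau_Cons)
  qed
  moreover have "sorted_wrt (<) (xs @ y # ys)"
    using sR xs ys AB by (fastforce simp: sorted_wrt_append)
  ultimately have "is_tableau ((xs @ y # ys) # T)"
    using T disj AB U' by (auto simp: is_tableau_Cons)
  moreover have x: "x \<notin> entries ((xs @ y # ys) # T)"
    using disj sR U' AB by (auto simp: sorted_wrt_append)
  moreover have "row_insert x ((xs @ y # ys) # T) = U"
    using row_insert_bump[OF xs AB(2) ys] U AB y by simp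
  moreover have "shape ((xs @ y # ys) # T) = a # \<mu>"
    using T R AB by (simp add: shape_def)
  ultimately show ?case
    by blast
qed

section \<open>Deletion of the largest entry\<close>

text \<open>Undoes the deletion of an \<open>m\<close> that ends its row; \<open>new_row\<close>
  covers a deletion that emptied the last row.\<close>

inductive appends :: "nat \<Rightarrow> tableau \<Rightarrow> tableau \<Rightarrow> bool" for m where
  new_row: "appends m [] [[m]]"
| here: "appends m (R # T) ((R @ [m]) # T)"
| later: "appends m T U \<Longrightarrow> appends m (R # T) (R # U)"

lemma entries_appends: "appends m T U \<Longrightarrow> entries U = insert m (entries T)"
  by (induction rule: appends.induct) auto

lemma appends_notin: "appends m T U \<Longrightarrow> is_tableau U \<Longrightarrow> m \<notin> entries T"
  by (induction rule: appends.induct)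
    (auto simp: is_tableau_Cons sorted_wrt_append dest: entries_appends)

lemma shape_appends: "appends m T U \<Longrightarrow> grows (shape T) (shape U)"
  by (induction rule: appends.induct)
    (auto simp: shape_def intro: grows.here grows.later grows.new_row[simplified])

text \<open>The row that became longer is visible in the shape, and the value written there is fixed
  in advance.\<close>

lemma appends_det:
  assumes "appends m T U" "appends m T V" "shape U = shape V"
  shows "U = V"
  using assms
proof (induction arbitrary: V rule: appends.induct)
  case new_row
  then show ?case by (auto elim: appends.cases)
next
  case (here R T)
  from here(1) show ?case
    by cases (use here(2) in \<open>auto simp: shape_def\<close>)
next
  case (later T U R)
  from later.prems(1) show ?case
    by cases (use later in \<open>auto simp: shape_def\<close>)
qed

lemma appends_grow:
  assumes "grows (shape T) \<nu>"
  shows "\<exists>U. appends m T U \<and> shape U = \<nu>"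
  using assms
proof (induction "shape T" \<nu> arbitrary: T rule: grows.induct)
  case new_row
  then show ?case
    by (auto simp: shape_def intro: appends.new_row intro!: exI[of _ "[[m]]"])
next
  case (here a \<mu>)
  then obtain R T' where "T = R # T'" "length R = a" "shape T' = \<mu>"
    by (cases T) (auto simp: shape_def)
  then show ?case
    by (auto simp: shape_def intro!: exI[of _ "(R @ [m]) # T'"] appends.here)
next
  case (later \<mu> \<nu> a)
  then obtain R T' where "T = R # T'" "length R = a" "\<mu> = shape T'"
    by (cases T) (auto simp: shape_def)
  moreover from this later(2)[of T'] obtain U where "appends m T' U" "shape U = \<nu>"
    by blast
  ultimately show ?case
    by (auto simp: shape_def intro!: exI[of _ "R # U"] appends.later)
qed

text \<open>A maximal \<open>m\<close> at the end of a row violates neither row nor column order, so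
  only the shape could go wrong.\<close>

lemma is_tableau_appends:
  assumes "appends m T U" "is_tableau T" "\<forall>x \<in> entries T. x < m" "is_int_partition (shape U)"
  shows "is_tableau U"
  using assms
proof (induction rule: appends.induct)
  case new_row
  then show ?case by (simp add: is_tableau_Cons)
next
  case (here R T)
  moreover have "below (R @ [m]) S" if "below R S" for S
    using that by (auto simp: below_def nth_append)
  ultimately show ?case
    by (auto simp: is_tableau_Cons sorted_wrt_append)
next
  case (later T U R)
  have U: "is_tableau U"
    using later by (auto simp: is_tableau_Cons shape_def is_int_partition_Cons)
  moreover have "U \<noteq> []"
    using later(1) by cases auto
  moreover have "below R (hd U)"
  proof -
    have "length (hd U) \<le> length R"
      using later(5) \<open>U \<noteq> []\<close> by (auto simp: shape_def is_int_partition_Cons hd_map)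
    moreover have "R ! c < hd U ! c" if "c < length (hd U)" for c
      using later(1)
    proof cases
      case new_row
      then show ?thesis
        using that later(3,4) by (auto simp: is_tableau_Cons)
    next
      case (here S T')
      then show ?thesis
        using that later(3,4) \<open>length (hd U) \<le> length R\<close>
        by (auto simp: is_tableau_Cons below_def nth_append less_Suc_eq)
    next
      case (later T' U' S)
      then show ?thesis
        using that \<open>is_tableau (R # T)\<close> by (auto simp: is_tableau_Cons below_def)
    qed
    ultimately show ?thesis
      by (simp add: below_def)
  qed
  moreover have "set R \<inter> entries U = {}"
    using entries_appends[OF later(1)] later(3,4) by (auto simp: is_tableau_Cons)
  ultimately show ?case
    using later(3) by (simp add: is_tableau_Cons)
qed

text \<open>The largest entry has nothing to its right and nothing below it, so it can be taken off
  its row.\<close>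

lemma appends_surj:
  assumes "is_tableau U" "m \<in> entries U" "\<forall>x \<in> entries U. x \<le> m"
  shows "\<exists>T. is_tableau T \<and> appends m T U"
  using assms
proof (induction U)
  case Nil
  then show ?case by simp
next
  case (Cons R U)
  show ?case
  proof (cases "m \<in> set R")
    case True
    then obtain R' S where "R = R' @ m # S"
      by (auto simp: in_set_conv_decomp)
    moreover have "S = []"
      using Cons.prems calculation by (cases S) (auto simp: is_tableau_Cons sorted_wrt_append)
    ultimately have R: "R = R' @ [m]"
      by simp
    have short: "length (hd U) \<le> length R'" if "U \<noteq> []"
    proof (rule ccontr)
      assume *: "\<not> ?thesis"
      then have "m < hd U ! length R'"
        using Cons.prems(1) that R
        by (auto simp: is_tableau_Cons below_def dest: spec[of _ "length R'"])
      moreover have "hd U ! length R' \<in> set (hd U)"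
        using * by simp
      moreover have "set (hd U) \<subseteq> entries U"
        using that by (cases U) auto
      ultimately show False
        using Cons.prems(3)
        by (metis UnCI entries_simps(2) leD subsetD)
    qed
    show ?thesis
    proof (cases "R' = []")
      case True
      \<comment> \<open>The row \<open>[m]\<close> disappears altogether; it was the last one, since
        the next could be no longer than the empty \<open>R'\<close>.\<close>
      then have "U = []"
        using short Cons.prems(1) by (cases U) (auto simp: is_tableau_Cons)
      then show ?thesis
        using R True by (auto intro!: exI[of _ "[]"] appends.new_row)
    next
      case False
      have "below R' (hd U)" if "U \<noteq> []"
        using Cons.prems(1) short that R by (auto simp: is_tableau_Cons below_def nth_append)
      then have "is_tableau (R' # U)"
        using Cons.prems(1) R False by (auto simp: is_tableau_Cons sorted_wrt_append)
      then show ?thesis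
        using R appends.here by blast
    qed
  next
    case False
    then obtain T where T: "is_tableau T" "appends m T U"
      using Cons by (auto simp: is_tableau_Cons)
    have "below R (hd T)" if "T \<noteq> []"
      using T(2)
    proof cases
      case (here S T')
      then show ?thesis
        using Cons.prems(1) by (auto simp: is_tableau_Cons below_def nth_append dest: spec split: if_splits)
    qed (use that Cons.prems(1) in \<open>auto simp: is_tableau_Cons\<close>)
    then have "is_tableau (R # T)"
      using Cons.prems(1) T entries_appends[OF T(2)] by (auto simp: is_tableau_Cons)
    then show ?thesis
      using T appends.later by blast
  qed
qed

text \<open>Matches \<open>remove_corner\<close>, which shortens a row and then filters out empty
  rows: \<open>R\<close> may be empty, and the filter then drops it.\<close>

lemma appends_decomp:
  assumes "appends m T U" "is_tableau T"
  obtains X R Y where "U = X @ (R @ [m]) # Y" "T = filter (\<lambda>R. R \<noteq> []) (X @ R # Y)"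
proof -
  have "\<exists>X R Y. U = X @ (R @ [m]) # Y \<and> T = filter (\<lambda>R. R \<noteq> []) (X @ R # Y)"
    using assms
  proof (induction rule: appends.induct)
    case new_row
    show ?case
      by (intro exI[of _ "[]"]) simp
  next
    case (here R T)
    then have "filter (\<lambda>R. R \<noteq> []) (R # T) = R # T"
      by (auto simp: is_tableau_def intro!: filter_True)
    then show ?case
      by (metis append_Nil)
  next
    case (later T U R)
    then obtain X R' Y where "U = X @ (R' @ [m]) # Y" "T = filter (\<lambda>R. R \<noteq> []) (X @ R' # Y)"
      by (auto simp: is_tableau_Cons)
    then show ?case
      using later(3) by (intro exI[of _ "R # X"] exI[of _ R'] exI[of _ Y]) (simp add: is_tableau_Cons)
  qed
  then show ?thesis
    using that by blast
qed

lemma entry_SomeD: "entry T (r, c) = Some x \<Longrightarrow> r < length T \<and> x \<in> set (T ! r)"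
  by (auto split: if_splits)

lemma entry_unique:
  assumes "entry (X @ (R @ [m]) # Y) p = Some m"
    and "distinct (concat (X @ (R @ [m]) # Y))"
  shows "p = (length X, length R)"
proof (cases p)
  case (Pair r c)
  have "m \<notin> entries X" "m \<notin> set R" "m \<notin> entries Y"
    using assms(2) by (auto simp: entries_def)
  then have "m \<notin> set (X ! r)" if "r < length X"
    using that by (auto simp: entries_def)
  moreover have "m \<notin> set (Y ! i)" if "i < length Y" for i
    using that \<open>m \<notin> entries Y\<close> by (auto simp: entries_def)
  ultimately have "r = length X"
    using entry_SomeD[of _ r c m] assms(1) Pair
    by (fastforce simp: nth_append nth_Cons' split: if_splits)
  moreover have "c = length R"
    using assms(1) Pair calculation \<open>m \<notin> set R\<close> nth_mem[of c R]
    by (auto simp: nth_append less_Suc_eq split: if_splits)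
  ultimately show ?thesis
    using Pair by simp
qed

lemma jdt_delete_appends:
  assumes "appends m T U" "is_tableau U" "is_tableau T" "\<forall>x \<in> entries U. x \<le> m"
  shows "jdt_delete m U = T"
proof -
  obtain X R Y where U: "U = X @ (R @ [m]) # Y" and T: "T = filter (\<lambda>R. R \<noteq> []) (X @ R # Y)"
    using appends_decomp assms by blast
  have "distinct (concat U)"
    using assms by (simp add: is_tableau_def)
  then have "(THE p. entry U p = Some m) = (length X, length R)"
    by (intro the_equality) (simp_all add: U nth_append entry_unique del: concat_append)
  \<comment> \<open>There is nothing to the right of \<open>m\<close>, which ends its row, and an
    entry below would exceed the maximum. So the slide stops at once.\<close>
  moreover have "entry U (Suc (length X), length R) = None"
  proof (rule ccontr)
    assume "\<not> ?thesis"
    then obtain S Y' where Y: "Y = S # Y'" and len: "length R < length S"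
      unfolding U by (cases Y) (auto simp: nth_append split: if_splits)
    have "below (R @ [m]) S"
      using assms(2) unfolding U Y is_tableau_def by (simp add: sorted_wrt_append)
    then have "m < S ! length R"
      using len by (auto simp: below_def dest: spec[of _ "length R"])
    moreover have "S ! length R \<in> entries U"
      using U Y len by (simp add: entries_def)
    ultimately show False
      using assms(4) by fastforce
  qed
  ultimately have "jdt_delete m U = remove_corner U (length X, length R)"
    unfolding jdt_delete_def U by (subst jdt_slide.simps) (simp add: nth_append)
  then show ?thesis
    by (simp add: U T nth_append)
qed

section \<open>Set partitions and arc diagrams\<close>

lemma finite_set_partitions: "finite S \<Longrightarrow> finite (set_partitions S)"
  by (simp add: set_partitions_def finitely_many_partition_on)

lemma image_image_in_set_partitions:
  assumes "inj_on f S" "D \<in> set_partitions S"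
  shows "image (image f) D \<in> set_partitions (f ` S)"
proof -
  have "{} \<notin> image f ` D"
    using assms(2) by (auto simp: set_partitions_def dest: partition_onD3)
  then show ?thesis
    using partition_on_inj_image[of S D f] assms by (simp add: set_partitions_def)
qed

lemma image_image_inverse:
  assumes "D \<in> set_partitions S" "\<And>x. x \<in> S \<Longrightarrow> g (f x) = x"
  shows "image (image g) (image (image f) D) = D"
proof -
  have "g ` f ` B = B" if "B \<in> D" for B
  proof -
    have "B \<subseteq> S"
      using that assms(1) by (auto simp: set_partitions_def dest: partition_onD1)
    then have "(\<lambda>x. g (f x)) ` B = id ` B"
      using assms(2) by (intro image_cong) auto
    then show ?thesis
      by (simp add: image_image)
  qed
  then have "(\<lambda>B. g ` f ` B) ` D = id ` D"
    by (intro image_cong) auto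
  then show ?thesis
    by (simp add: image_comp comp_def)
qed

lemma bij_betw_set_partitions:
  assumes "bij_betw f S S'"
  shows "bij_betw (image (image f)) (set_partitions S) (set_partitions S')"
proof (rule bij_betw_byWitness[where f' = "image (image (the_inv_into S f))"])
  have f: "inj_on f S" "f ` S = S'"
    using assms by (auto simp: bij_betw_def)
  have g: "inj_on (the_inv_into S f) S'" "the_inv_into S f ` S' = S"
    using bij_betw_the_inv_into[OF assms] by (auto simp: bij_betw_def)
  show "image (image f) ` set_partitions S \<subseteq> set_partitions S'"
    using image_image_in_set_partitions[OF f(1)] f(2) by auto
  show "image (image (the_inv_into S f)) ` set_partitions S' \<subseteq> set_partitions S"
    using image_image_in_set_partitions[OF g(1)] g(2) by auto
  show "\<forall>D \<in> set_partitions S. image (image (the_inv_into S f)) (image (image f) D) = D"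
    using f by (intro ballI image_image_inverse) (auto simp: the_inv_into_f_f)
  show "\<forall>D \<in> set_partitions S'. image (image f) (image (image (the_inv_into S f)) D) = D"
    using f by (intro ballI image_image_inverse) (auto simp: f_the_inv_into_f)
qed

lemma bij_betw_std_vertex: "bij_betw (std_vertex k) (Top ` {1..k} \<union> Bot ` {1..k}) {1..2 * k}"
proof (rule bij_betw_imageI)
  show "inj_on (std_vertex k) (Top ` {1..k} \<union> Bot ` {1..k})"
    by (auto simp: inj_on_def)
  show "std_vertex k ` (Top ` {1..k} \<union> Bot ` {1..k}) = {1..2 * k}"
  proof (intro equalityI subsetI)
    fix x assume x: "x \<in> {1..2 * k}"
    show "x \<in> std_vertex k ` (Top ` {1..k} \<union> Bot ` {1..k})"
    proof (cases "x \<le> k")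
      case True
      then have "Top x \<in> Top ` {1..k} \<union> Bot ` {1..k}" "x = std_vertex k (Top x)"
        using x by auto
      then show ?thesis by blast
    next
      case False
      then have "Bot (2 * k + 1 - x) \<in> Top ` {1..k} \<union> Bot ` {1..k}"
        using x by (intro UnI2 imageI) auto
      moreover have "x = std_vertex k (Bot (2 * k + 1 - x))"
        using x False by auto
      ultimately show ?thesis by blast
    qed
  qed auto
qed

lemma bij_betw_std_rep: "bij_betw (std_rep k) (A k) (set_partitions {1..2 * k})"
  unfolding std_rep_def [abs_def] A_def by (rule bij_betw_set_partitions[OF bij_betw_std_vertex])

text \<open>Edge sets of set partitions, described without blocks: each component is an increasing
  path, and the vertex sets of these paths are the blocks.\<close>

definition arc_diagrams :: "nat \<Rightarrow> (nat \<times> nat) set set" where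
  "arc_diagrams N = {E. E \<subseteq> {1..N} \<times> {1..N} \<and> (\<forall>(i, j) \<in> E. i < j) \<and>
     single_valued E \<and> single_valued (E\<inverse>)}"

lemma edges_in_arc_diagrams:
  assumes "partition_on {1..N} D"
  shows "edges D \<in> arc_diagrams N"
proof -
  have eq: "B = B'" if "B \<in> D" "B' \<in> D" "i \<in> B" "i \<in> B'" for B B' i
    using partition_onD2[OF assms] that by (auto simp: disjoint_def)
  have "single_valued (edges D)"
  proof (rule single_valuedI)
    fix i j j' assume "(i, j) \<in> edges D" "(i, j') \<in> edges D"
    then obtain B B' where B: "B \<in> D" "i \<in> B" "i < j" "j \<in> B" "\<forall>m. i < m \<and> m < j \<longrightarrow> m \<notin> B"
      and B': "B' \<in> D" "i \<in> B'" "i < j'" "j' \<in> B'" "\<forall>m. i < m \<and> m < j' \<longrightarrow> m \<notin> B'"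
      by (auto simp: edges_def)
    have "B = B'"
      using B(1,2) B'(1,2) by (intro eq)
    with B B' show "j = j'"
      by (cases j j' rule: linorder_cases) auto
  qed
  moreover have "single_valued ((edges D)\<inverse>)"
  proof (rule single_valuedI)
    fix i i' j assume "(j, i) \<in> (edges D)\<inverse>" "(j, i') \<in> (edges D)\<inverse>"
    then obtain B B' where B: "B \<in> D" "j \<in> B" "i < j" "i \<in> B" "\<forall>m. i < m \<and> m < j \<longrightarrow> m \<notin> B"
      and B': "B' \<in> D" "j \<in> B'" "i' < j" "i' \<in> B'" "\<forall>m. i' < m \<and> m < j \<longrightarrow> m \<notin> B'"
      by (auto simp: edges_def)
    have "B = B'"
      using B(1,2) B'(1,2) by (intro eq)
    with B B' show "i = i'"
      by (cases i i' rule: linorder_cases) auto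
  qed
  moreover have "edges D \<subseteq> {1..N} \<times> {1..N}" "\<forall>(i, j) \<in> edges D. i < j"
    unfolding partition_onD1[OF assms] by (auto simp: edges_def)
  ultimately show ?thesis
    unfolding arc_diagrams_def by blast
qed

lemma edge_path_in_block:
  assumes "B \<in> D" "i \<in> B" "j \<in> B" "i \<le> j"
  shows "(i, j) \<in> (edges D)\<^sup>*"
  using assms(2-)
proof (induction "j - i" arbitrary: i j rule: less_induct)
  case less
  show ?case
  proof (cases "\<exists>m. i < m \<and> m < j \<and> m \<in> B")
    case True
    then obtain m where "i < m" "m < j" "m \<in> B" by blast
    then have "(i, m) \<in> (edges D)\<^sup>*" "(m, j) \<in> (edges D)\<^sup>*"
      using less by auto
    then show ?thesis by simp
  next
    case False
    then have "i = j \<or> (i, j) \<in> edges D"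
      using less.prems assms(1) by (auto simp: edges_def)
    then show ?thesis by blast
  qed
qed

lemma block_closed_under_edges:
  assumes "disjoint D" "B \<in> D" "(i, j) \<in> (edges D)\<^sup>*"
  shows "i \<in> B \<longleftrightarrow> j \<in> B"
  using assms(3)
proof induction
  case (step j m)
  then obtain B' where "B' \<in> D" "j \<in> B'" "m \<in> B'"
    by (auto simp: edges_def)
  then have "j \<in> B \<longleftrightarrow> m \<in> B"
    using assms(1,2) unfolding disjoint_def by blast
  with step show ?case by simp
qed simp

text \<open>Consecutive elements of a block are joined, so edge paths recover the blocks; this gives
  injectivity of \<open>edges\<close>.\<close>

lemma same_block_iff:
  assumes "partition_on S D"
  shows "(\<exists>B \<in> D. i \<in> B \<and> j \<in> B) \<longleftrightarrow>
    i \<in> S \<and> j \<in> S \<and> ((i, j) \<in> (edges D)\<^sup>* \<or> (j, i) \<in> (edges D)\<^sup>*)" (is "?L \<longleftrightarrow> ?R")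
proof
  assume ?L
  then obtain B where B: "B \<in> D" "i \<in> B" "j \<in> B" by blast
  then have "(i, j) \<in> (edges D)\<^sup>* \<or> (j, i) \<in> (edges D)\<^sup>*"
    using edge_path_in_block[of B D i j] edge_path_in_block[of B D j i] nat_le_linear[of i j]
    by auto
  with B show ?R
    using partition_onD1[OF assms] by auto
next
  assume R: ?R
  then obtain B where B: "B \<in> D" "i \<in> B"
    using partition_onD1[OF assms] by blast
  then have "j \<in> B"
    using R block_closed_under_edges[OF partition_onD2[OF assms] B(1), of i j]
      block_closed_under_edges[OF partition_onD2[OF assms] B(1), of j i] by auto
  with B show ?L by blast
qed

text \<open>The blocks are the connected components of \<open>E\<close>. No vertex has two outgoing
  or two incoming arcs, so a component is a single path, and being joined by a path in one of the
  two directions is already transitive.\<close>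

lemma edges_surj:
  assumes "E \<in> arc_diagrams N"
  shows "\<exists>D. partition_on {1..N} D \<and> edges D = E"
proof -
  have E: "E \<subseteq> {1..N} \<times> {1..N}" "\<And>i j. (i, j) \<in> E \<Longrightarrow> i < j"
    and sv: "single_valued E" "single_valued (E\<inverse>)"
    using assms by (auto simp: arc_diagrams_def)
  have le: "i \<le> j" if "(i, j) \<in> E\<^sup>*" for i j
    using that by induction (auto dest: E(2))
  define r where "r = {(i, j). i \<in> {1..N} \<and> j \<in> {1..N} \<and> ((i, j) \<in> E\<^sup>* \<or> (j, i) \<in> E\<^sup>*)}"
  \<comment> \<open>Two vertices with paths to a common vertex lie on one path: this is confluence
    of the single-valued converse.\<close>
  have comparable: "(i, m) \<in> E\<^sup>* \<or> (m, i) \<in> E\<^sup>*"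
    if "(i, j) \<in> E\<^sup>*" "(m, j) \<in> E\<^sup>*" for i j m
    using single_valued_confluent[OF sv(2), of j i m] that
    by (auto simp: rtrancl_converse)
  have "equiv {1..N} r"
  proof (rule equivI)
    show "trans r"
    proof (rule transI)
      fix i j m assume "(i, j) \<in> r" "(j, m) \<in> r"
      then show "(i, m) \<in> r"
        using single_valued_confluent[OF sv(1), of j i m] comparable[of i j m]
        by (auto simp: r_def intro: rtrancl_trans)
    qed
  qed (auto simp: r_def refl_on_def sym_def)
  define D where "D = {1..N} // r"
  have part: "partition_on {1..N} D"
    unfolding D_def by (rule partition_on_quotient[OF \<open>equiv {1..N} r\<close>])
  have block: "j \<in> B \<longleftrightarrow> (i, j) \<in> r" if "B \<in> D" "i \<in> B" for i j B
    using that \<open>equiv {1..N} r\<close> unfolding D_def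
    using in_quotient_imp_in_rel[of "{1..N}" r B i j] in_quotient_imp_closed[of "{1..N}" r B i j]
    by auto
  have "edges D = E"
  proof (intro equalityI subrelI)
    fix i j assume "(i, j) \<in> edges D"
    then obtain B where B: "i < j" "B \<in> D" "i \<in> B" "j \<in> B"
      and gap: "\<And>m. i < m \<Longrightarrow> m < j \<Longrightarrow> m \<notin> B"
      by (auto simp: edges_def)
    then have "(i, j) \<in> r"
      using block by blast
    then have "(i, j) \<in> E\<^sup>*"
      using le[of j i] B(1) by (auto simp: r_def)
    \<comment> \<open>The first arc of the path from \<open>i\<close> leads to a block element
      beyond \<open>i\<close> and at most \<open>j\<close>; since no block element lies strictly
      between, it is \<open>j\<close>.\<close>
    then obtain m where m: "(i, m) \<in> E" "(m, j) \<in> E\<^sup>*"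
      using B(1) by (auto elim: converse_rtranclE)
    then have "(i, m) \<in> r"
      using E(1) by (auto simp: r_def)
    then have "m \<in> B"
      using block B by blast
    then have "m = j"
      using gap[of m] E(2)[OF m(1)] le[OF m(2)] by fastforce
    with m show "(i, j) \<in> E" by simp
  next
    fix i j assume ij: "(i, j) \<in> E"
    then have "i \<in> {1..N}"
      using E by blast
    then obtain B where B: "B \<in> D" "i \<in> B"
      using partition_onD1[OF part] by blast
    have "(i, j) \<in> r"
      using ij E(1) by (auto simp: r_def)
    then have "j \<in> B"
      using B block by blast
    moreover have "m \<notin> B" if between: "i < m" "m < j" for m
    proof
      assume "m \<in> B"
      then have "(i, m) \<in> E\<^sup>*"
        using block[OF B] le[of m i] between by (auto simp: r_def)
      then obtain j' where "(i, j') \<in> E" "(j', m) \<in> E\<^sup>*"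
        using between by (auto elim: converse_rtranclE)
      then have "(j, m) \<in> E\<^sup>*"
        using single_valuedD[OF sv(1) ij] by auto
      then show False
        using le[of j m] between by simp
    qed
    ultimately show "(i, j) \<in> edges D"
      using B E(2)[OF ij] by (auto simp: edges_def)
  qed
  with part show ?thesis by blast
qed

lemma bij_betw_edges: "bij_betw edges (set_partitions {1..N}) (arc_diagrams N)"
proof (rule bij_betw_imageI)
  show "inj_on edges (set_partitions {1..N})"
  proof (rule inj_onI)
    fix D D' assume "D \<in> set_partitions {1..N}" "D' \<in> set_partitions {1..N}"
      and eq: "edges D = edges D'"
    then have D: "partition_on {1..N} D" "partition_on {1..N} D'"
      by (auto simp: set_partitions_def)
    then have "{(x, y). \<exists>p \<in> D. x \<in> p \<and> y \<in> p} = {(x, y). \<exists>p \<in> D'. x \<in> p \<and> y \<in> p}"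
      by (simp add: same_block_iff eq)
    then show "D = D'"
      using partition_on_eq_quotient[OF D(1)] partition_on_eq_quotient[OF D(2)] by simp
  qed
  show "edges ` set_partitions {1..N} = arc_diagrams N"
  proof (intro equalityI subsetI)
    fix E assume "E \<in> arc_diagrams N"
    then obtain D where "partition_on {1..N} D" "edges D = E"
      using edges_surj by blast
    then show "E \<in> edges ` set_partitions {1..N}"
      unfolding set_partitions_def by blast
  next
    fix E assume "E \<in> edges ` set_partitions {1..N}"
    then obtain D where "partition_on {1..N} D" "E = edges D"
      unfolding set_partitions_def by blast
    then show "E \<in> arc_diagrams N"
      using edges_in_arc_diagrams by blast
  qed
qed

section \<open>Runs of the insertion algorithm\<close>

text \<open>Labels of the arcs opened by vertex \<open>a\<close> and not closed by vertex
  \<open>b\<close>. The bounds differ at the half step where vertex \<open>Suc i\<close> has closed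
  an arc but not yet opened one: there \<open>a = i\<close> and \<open>b = Suc i\<close>.\<close>

definition arc_labels :: "nat \<Rightarrow> (nat \<times> nat) set \<Rightarrow> nat \<Rightarrow> nat \<Rightarrow> nat set" where
  "arc_labels N E a b = {Suc N - j | i j. (i, j) \<in> E \<and> i \<le> a \<and> b < j}"

text \<open>Positions are doubled: \<open>T (2 * i)\<close> is the tableau after vertex
  \<open>i\<close>, and \<open>N - i\<close> is the label of an arc ending at \<open>Suc i\<close>.
  \<open>T\<close> is a parameter rather than \<open>insertion_tableau\<close>, so that tableaux
  rebuilt from shapes are instances too; beyond index \<open>2 * N\<close> it is
  unconstrained.\<close>

locale arc_run =
  fixes N :: nat and E :: "(nat \<times> nat) set" and T :: "nat \<Rightarrow> tableau"
  assumes arcs: "E \<in> arc_diagrams N"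
    and start: "T 0 = []"
    and right_end: "i < N \<Longrightarrow>
      T (Suc (2 * i)) = (if Suc i \<in> Range E then jdt_delete (N - i) (T (2 * i)) else T (2 * i))"
    and left_end: "i < N \<Longrightarrow> (Suc i, j) \<in> E \<Longrightarrow>
      T (Suc (Suc (2 * i))) = row_insert (Suc N - j) (T (Suc (2 * i)))"
    and no_left_end: "i < N \<Longrightarrow> Suc i \<notin> Domain E \<Longrightarrow> T (Suc (Suc (2 * i))) = T (Suc (2 * i))"
begin

lemma arc_bounds: "(i, j) \<in> E \<Longrightarrow> 1 \<le> i \<and> i < j \<and> j \<le> N"
  using arcs by (auto simp: arc_diagrams_def)

lemma left_unique: "(i, j) \<in> E \<Longrightarrow> (i, j') \<in> E \<Longrightarrow> j = j'"
  using arcs by (auto simp: arc_diagrams_def dest: single_valuedD)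

lemma right_unique: "(i, j) \<in> E \<Longrightarrow> (i', j) \<in> E \<Longrightarrow> i = i'"
  using arcs by (auto simp: arc_diagrams_def single_valued_def)

section \<open>Labels of the open arcs along a run\<close>

lemma arc_labels_Suc_right:
  assumes "i < N"
  shows "arc_labels N E i (Suc i) = arc_labels N E i i - {N - i}"
proof (intro equalityI subsetI)
  fix x assume "x \<in> arc_labels N E i (Suc i)"
  then obtain i' j where ij: "(i', j) \<in> E" "i' \<le> i" "Suc i < j" "x = Suc N - j"
    by (auto simp: arc_labels_def)
  moreover have "x \<noteq> N - i" "i < j"
    using arc_bounds[OF ij(1)] ij(3,4) by linarith+
  ultimately show "x \<in> arc_labels N E i i - {N - i}"
    unfolding arc_labels_def by blast
next
  fix x assume "x \<in> arc_labels N E i i - {N - i}"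
  then obtain i' j where ij: "(i', j) \<in> E" "i' \<le> i" "i < j" "x = Suc N - j" "x \<noteq> N - i"
    by (auto simp: arc_labels_def)
  moreover have "Suc i < j"
    using ij(3-5) by (cases "j = Suc i") auto
  ultimately show "x \<in> arc_labels N E i (Suc i)"
    unfolding arc_labels_def by blast
qed

lemma label_mem_iff_right_end:
  assumes "i < N"
  shows "N - i \<in> arc_labels N E i i \<longleftrightarrow> Suc i \<in> Range E"
proof
  assume "N - i \<in> arc_labels N E i i"
  then obtain i' j where ij: "(i', j) \<in> E" "i < j" "N - i = Suc N - j"
    by (auto simp: arc_labels_def)
  then have "j = Suc i"
    using arc_bounds[OF ij(1)] assms by linarith
  with ij show "Suc i \<in> Range E" by blast
next
  assume "Suc i \<in> Range E"
  then obtain i' where i': "(i', Suc i) \<in> E" by blast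
  then show "N - i \<in> arc_labels N E i i"
    using arc_bounds[OF i'] unfolding arc_labels_def
    by (intro CollectI exI[of _ i'] exI[of _ "Suc i"]) simp
qed

lemma arc_labels_Suc_left:
  "arc_labels N E (Suc i) (Suc i) = arc_labels N E i (Suc i) \<union> (\<lambda>j. Suc N - j) ` E `` {Suc i}"
proof -
  have "Suc i < j" if "(Suc i, j) \<in> E" for j
    using arc_bounds[OF that] by simp
  then show ?thesis
    unfolding arc_labels_def le_Suc_eq by blast
qed

lemma right_step:
  assumes "i < N" "is_tableau (T (2 * i))" "entries (T (2 * i)) = arc_labels N E i i"
  shows "is_tableau (T (Suc (2 * i))) \<and> entries (T (Suc (2 * i))) = arc_labels N E i (Suc i) \<and>
    (if Suc i \<in> Range E then appends (N - i) (T (Suc (2 * i))) (T (2 * i))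
     else T (Suc (2 * i)) = T (2 * i))"
proof (cases "Suc i \<in> Range E")
  case True
  then have "N - i \<in> arc_labels N E i i"
    using label_mem_iff_right_end[OF assms(1)] by simp
  moreover have max: "\<forall>x \<in> arc_labels N E i i. x \<le> N - i"
    by (auto simp: arc_labels_def)
  \<comment> \<open>The result is found before the deletion is evaluated: taking off the largest
    entry gives \<open>U\<close>, and \<open>jdt_delete_appends\<close> identifies it with the
    outcome.\<close>
  ultimately obtain U where U: "is_tableau U" "appends (N - i) U (T (2 * i))"
    using appends_surj[of "T (2 * i)" "N - i"] assms by auto
  have "T (Suc (2 * i)) = U"
    using right_end[OF assms(1)] True jdt_delete_appends[OF U(2) assms(2) U(1)] max assms(3) by simp
  moreover have "entries U = arc_labels N E i i - {N - i}"
    using entries_appends[OF U(2)] appends_notin[OF U(2) assms(2)] assms(3) by auto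
  ultimately show ?thesis
    using U True arc_labels_Suc_right[OF assms(1)] by simp
next
  case False
  then have "arc_labels N E i i = arc_labels N E i (Suc i)"
    using label_mem_iff_right_end[OF assms(1)] arc_labels_Suc_right[OF assms(1)] by simp
  then show ?thesis
    using False right_end[OF assms(1)] assms by simp
qed

text \<open>Two arcs with equal labels would share their right endpoint. Right endpoints are at most
  \<open>N\<close>, so truncated subtraction loses nothing.\<close>

lemma left_step:
  assumes "i < N" "entries (T (Suc (2 * i))) = arc_labels N E i (Suc i)" "(Suc i, j) \<in> E"
  shows "Suc N - j \<notin> entries (T (Suc (2 * i)))"
proof
  assume "Suc N - j \<in> entries (T (Suc (2 * i)))"
  then obtain i' j' where ij: "(i', j') \<in> E" "i' \<le> i" "Suc N - j = Suc N - j'"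
    using assms by (auto simp: arc_labels_def)
  then have "j = j'"
    using arc_bounds[OF ij(1)] arc_bounds[OF assms(3)] by linarith
  then show False
    using right_unique[OF ij(1)] assms(3) ij(2) by fastforce
qed

lemma even_step:
  assumes "i < N" "is_tableau (T (Suc (2 * i)))"
    and "entries (T (Suc (2 * i))) = arc_labels N E i (Suc i)"
  shows "is_tableau (T (2 * Suc i)) \<and> entries (T (2 * Suc i)) = arc_labels N E (Suc i) (Suc i)"
proof (cases "Suc i \<in> Domain E")
  case True
  then obtain j where j: "(Suc i, j) \<in> E" by blast
  have "arc_labels N E (Suc i) (Suc i) = insert (Suc N - j) (arc_labels N E i (Suc i))"
  proof -
    have "E `` {Suc i} = {j}"
      using j left_unique by blast
    then show ?thesis
      by (simp add: arc_labels_Suc_left)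
  qed
  then show ?thesis
    using left_end[OF assms(1) j] left_step[OF assms(1,3) j] assms(2,3)
    by (simp add: is_tableau_row_insert entries_row_insert)
next
  case False
  then have "arc_labels N E (Suc i) (Suc i) = arc_labels N E i (Suc i)"
    using arc_labels_Suc_left[of i] by (simp add: Image_def Domain_iff)
  then show ?thesis
    using False no_left_end[OF assms(1)] assms by simp
qed

lemma even_state:
  assumes "i \<le> N"
  shows "is_tableau (T (2 * i)) \<and> entries (T (2 * i)) = arc_labels N E i i"
  using assms
proof (induction i)
  case 0
  have "arc_labels N E 0 0 = {}"
    using arc_bounds by (fastforce simp: arc_labels_def)
  then show ?case
    by (simp add: start)
next
  case (Suc i)
  then show ?case
    using right_step[of i] even_step[of i] by simp
qed

lemma odd_state:
  assumes "i < N"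
  shows "is_tableau (T (Suc (2 * i)))" "entries (T (Suc (2 * i))) = arc_labels N E i (Suc i)"
    "if Suc i \<in> Range E then appends (N - i) (T (Suc (2 * i))) (T (2 * i))
     else T (Suc (2 * i)) = T (2 * i)"
  using right_step even_state[of i] assms by auto

lemma left_cases:
  assumes "i < N"
  obtains (insert) j where "(Suc i, j) \<in> E" "Suc N - j \<notin> entries (T (Suc (2 * i)))"
      "T (2 * Suc i) = row_insert (Suc N - j) (T (Suc (2 * i)))"
      "grows (shape (T (Suc (2 * i)))) (shape (T (2 * Suc i)))"
  | (stay) "Suc i \<notin> Domain E" "T (2 * Suc i) = T (Suc (2 * i))"
proof (cases "Suc i \<in> Domain E")
  case True
  then obtain j where j: "(Suc i, j) \<in> E" by blast
  note fresh = left_step[OF assms odd_state(2)[OF assms] j]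
  have "T (2 * Suc i) = row_insert (Suc N - j) (T (Suc (2 * i)))"
    using left_end[OF assms j] by simp
  then show ?thesis
    using insert[OF j fresh] shape_row_insert[OF odd_state(1)[OF assms] fresh] by simp
next
  case False
  then show ?thesis
    using stay no_left_end[OF assms] by simp
qed

lemma is_int_partition_run:
  assumes "n \<le> 2 * N"
  shows "is_int_partition (shape (T n))"
proof (cases "even n")
  case True
  then show ?thesis
    using even_state[of "n div 2"] assms by (auto intro: is_int_partition_shape)
next
  case False
  then obtain i where "n = Suc (2 * i)"
    by (auto elim: oddE)
  then show ?thesis
    using odd_state[of i] assms by (auto intro: is_int_partition_shape)
qed

lemma final: "T (2 * N) = []"
proof -
  have "arc_labels N E N N = {}"
    using arc_bounds by (fastforce simp: arc_labels_def)
  then show ?thesis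
    using even_state[of N] by (cases "T (2 * N)") (auto simp: is_tableau_Cons)
qed

lemma right_shapes:
  assumes "i < N"
  shows "shape (T (Suc (2 * i))) = shape (T (2 * i)) \<or>
    grows (shape (T (Suc (2 * i)))) (shape (T (2 * i)))"
  using odd_state(3)[OF assms] shape_appends by (auto split: if_splits)

lemma left_shapes:
  assumes "i < N"
  shows "shape (T (2 * Suc i)) = shape (T (Suc (2 * i))) \<or>
    grows (shape (T (Suc (2 * i)))) (shape (T (2 * Suc i)))"
  by (rule left_cases[OF assms]) auto

text \<open>Arcs open after vertex \<open>i\<close> end in \<open>{Suc i..N}\<close>, which leaves
  \<open>N - i\<close> possible labels. With \<open>N = 2 * k\<close> and \<open>i = k\<close> this
  puts the middle shape into \<open>Gamma k\<close>.\<close>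

lemma sum_list_shape_even:
  assumes "i \<le> N"
  shows "sum_list (shape (T (2 * i))) \<le> N - i"
proof -
  have "arc_labels N E i i \<subseteq> {1..N - i}"
    using arc_bounds by (fastforce simp: arc_labels_def)
  then have "card (entries (T (2 * i))) \<le> card {1..N - i}"
    using even_state[OF assms] by (intro card_mono) auto
  then show ?thesis
    using even_state[OF assms] by (simp add: sum_list_shape)
qed

end

text \<open>The shapes decide whether each half step acted, because an action always changes the
  shape. An insertion is undone by \<open>row_insert_inj\<close>, which also returns the label and
  so the arc starting at \<open>Suc i\<close>; a deletion is undone by
  \<open>appends_det\<close>.\<close>

lemma run_back_step:
  assumes "arc_run N E T" "arc_run N E' T'" "i < N"
    and "shape (T (2 * i)) = shape (T' (2 * i))"
    and "shape (T (Suc (2 * i))) = shape (T' (Suc (2 * i)))"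
    and "T (2 * Suc i) = T' (2 * Suc i)"
  shows "T (2 * i) = T' (2 * i) \<and> (\<forall>j. (Suc i, j) \<in> E \<longleftrightarrow> (Suc i, j) \<in> E')"
proof -
  interpret r: arc_run N E T by fact
  interpret r': arc_run N E' T' by fact
  have *: "T (Suc (2 * i)) = T' (Suc (2 * i)) \<and> (\<forall>j. (Suc i, j) \<in> E \<longleftrightarrow> (Suc i, j) \<in> E')"
  proof (cases rule: r.left_cases[OF assms(3), case_names insert stay])
    case (insert j)
    note ins = this
    show ?thesis
    proof (cases rule: r'.left_cases[OF assms(3), case_names insert stay])
      case (insert j')
      then have "Suc N - j = Suc N - j' \<and> T (Suc (2 * i)) = T' (Suc (2 * i))"
        using ins assms(5,6) r.odd_state(1)[OF assms(3)] r'.odd_state(1)[OF assms(3)]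
        by (intro row_insert_inj) auto
      moreover have "j = j'"
        using calculation r.arc_bounds[OF ins(1)] r'.arc_bounds[OF insert(1)] by linarith
      ultimately show ?thesis
        using ins(1) insert(1) r.left_unique r'.left_unique by blast
    next
      case stay
      then show ?thesis
        using ins(4) assms(5,6) grows_neq by metis
    qed
  next
    case stay
    note st = this
    show ?thesis
    proof (cases rule: r'.left_cases[OF assms(3), case_names insert stay])
      case (insert j')
      then show ?thesis
        using st assms(5,6) grows_neq by metis
    next
      case stay
      then show ?thesis
        using st assms(6) by auto
    qed
  qed
  moreover have "T (2 * i) = T' (2 * i)"
    using r.odd_state(3)[OF assms(3)] r'.odd_state(3)[OF assms(3)] * assms(4)
      shape_appends grows_neq appends_det
    by (auto split: if_splits) metis+
  ultimately show ?thesis by blast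
qed

lemma arcs_determined_by_shapes:
  assumes "arc_run N E T" "arc_run N E' T'"
    and "\<And>n. n \<le> 2 * N \<Longrightarrow> shape (T n) = shape (T' n)"
  shows "E = E'"
proof -
  interpret r: arc_run N E T by fact
  interpret r': arc_run N E' T' by fact
  note step = run_back_step[OF assms(1,2)]
  have eq: "T (2 * i) = T' (2 * i)" if "i \<le> N" for i
    using that
  proof (induction rule: inc_induct)
    case base
    show ?case by (simp add: r.final r'.final)
  next
    case (step i)
    then show ?case
      using run_back_step[OF assms(1,2), of i] assms(3) by simp
  qed
  have "(Suc i, j) \<in> E \<longleftrightarrow> (Suc i, j) \<in> E'" if "i < N" for i j
    using step[OF that] eq[of "Suc i"] assms(3) that by simp
  then have "(i, j) \<in> E \<longleftrightarrow> (i, j) \<in> E'" for i j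
    using r.arc_bounds[of i j] r'.arc_bounds[of i j] by (cases i) auto
  then show ?thesis by auto
qed

text \<open>The forward counterpart: it identifies tableaux rebuilt from shapes with those of the
  algorithm.\<close>

lemma arc_run_unique:
  assumes "arc_run N E T" "arc_run N E T'" "n \<le> 2 * N"
  shows "T n = T' n"
  using assms(3)
proof (induction n)
  case 0
  then show ?case
    using assms(1,2) by (simp add: arc_run.start)
next
  case (Suc n)
  interpret r: arc_run N E T by fact
  interpret r': arc_run N E T' by fact
  show ?case
  proof (cases "even n")
    case True
    then obtain i where "n = 2 * i" by (auto elim: evenE)
    then show ?thesis
      using r.right_end[of i] r'.right_end[of i] Suc by simp
  next
    case False
    then obtain i where n: "n = Suc (2 * i)" by (auto elim: oddE)
    show ?thesis
      using n Suc r.left_end[of i] r'.left_end[of i] r.no_left_end[of i] r'.no_left_end[of i]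
      by (cases "Suc i \<in> Domain E") auto
  qed
qed

section \<open>Reconstructing a run from its shapes\<close>

text \<open>With \<open>grows\<close> in place of \<open>adds_box\<close>, a vacillating tableau of
  empty shape with \<open>N\<close> double steps. Being a function, it can be indexed from either
  end.\<close>

definition oscillating :: "nat \<Rightarrow> (nat \<Rightarrow> nat list) \<Rightarrow> bool" where
  "oscillating N s \<longleftrightarrow> s 0 = [] \<and> s (2 * N) = [] \<and> (\<forall>n \<le> 2 * N. is_int_partition (s n)) \<and>
     (\<forall>i < N. (s (Suc (2 * i)) = s (2 * i) \<or> grows (s (Suc (2 * i))) (s (2 * i))) \<and>
        (s (2 * Suc i) = s (Suc (2 * i)) \<or> grows (s (Suc (2 * i))) (s (2 * Suc i))))"

lemma oscillating_run:
  assumes "arc_run N E T"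
  shows "oscillating N (\<lambda>n. shape (T n))"
proof -
  interpret arc_run N E T by fact
  show ?thesis
    using start final is_int_partition_run right_shapes left_shapes
    unfolding oscillating_def by (auto simp: shape_def)
qed

text \<open>\<open>T\<close>, \<open>U\<close>, \<open>V\<close> stand at positions
  \<open>2 * i\<close>, \<open>2 * i + 1\<close>, \<open>2 * i + 2\<close>, and \<open>a\<close> is
  the label inserted between the last two. The strict bound for \<open>U\<close> makes
  \<open>N - i\<close> new and larger than everything in \<open>U\<close>.\<close>

definition back_step ::
  "nat \<Rightarrow> (nat \<Rightarrow> nat list) \<Rightarrow> nat \<Rightarrow> tableau \<Rightarrow> tableau \<Rightarrow> nat option \<Rightarrow> tableau \<Rightarrow> bool" where
  "back_step N s i T U a V \<longleftrightarrow>
     is_tableau T \<and> shape T = s (2 * i) \<and> entries T \<subseteq> {1..N - i} \<and>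
     is_tableau U \<and> shape U = s (Suc (2 * i)) \<and> entries U \<subseteq> {1..<N - i} \<and>
     (T = U \<or> appends (N - i) U T) \<and>
     (case a of None \<Rightarrow> V = U | Some x \<Rightarrow> x \<notin> entries U \<and> V = row_insert x U)"

text \<open>Starting from \<open>V\<close>, reverse bumping yields \<open>U\<close>, and writing
  \<open>N - i\<close> into the reappearing box yields \<open>T\<close>; a half step with equal
  shapes copies the tableau.\<close>

lemma back_step_exists:
  assumes s: "oscillating N s" and "i < N"
    and V: "is_tableau V" "shape V = s (2 * Suc i)" "entries V \<subseteq> {1..N - Suc i}"
  shows "\<exists>T U a. back_step N s i T U a V"
proof -
  have part: "is_int_partition (s (Suc (2 * i)))" "is_int_partition (s (2 * i))"
    using s \<open>i < N\<close> by (auto simp: oscillating_def)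
  have V': "entries V \<subseteq> {1..<N - i}"
    using V(3) \<open>i < N\<close> by (auto dest!: subsetD)
  have "\<exists>U a. is_tableau U \<and> shape U = s (Suc (2 * i)) \<and> entries U \<subseteq> entries V \<and>
     (case a of None \<Rightarrow> V = U | Some x \<Rightarrow> x \<notin> entries U \<and> V = row_insert x U)"
  proof (cases "s (2 * Suc i) = s (Suc (2 * i))")
    case True
    then show ?thesis
      using V by (intro exI[of _ V] exI[of _ None]) simp
  next
    case False
    then have "grows (s (Suc (2 * i))) (shape V)"
      using s \<open>i < N\<close> V by (auto simp: oscillating_def)
    then obtain x U where "is_tableau U" "x \<notin> entries U" "shape U = s (Suc (2 * i))"
      "row_insert x U = V"
      using row_insert_surj part V by blast
    then show ?thesis
      using entries_row_insert[of U x] by (intro exI[of _ U] exI[of _ "Some x"]) auto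
  qed
  then obtain U a where U: "is_tableau U" "shape U = s (Suc (2 * i))" "entries U \<subseteq> {1..<N - i}"
     and a: "case a of None \<Rightarrow> V = U | Some x \<Rightarrow> x \<notin> entries U \<and> V = row_insert x U"
    using V' by blast
  have "\<exists>T. is_tableau T \<and> shape T = s (2 * i) \<and> entries T \<subseteq> {1..N - i} \<and>
     (T = U \<or> appends (N - i) U T)"
  proof (cases "s (2 * i) = s (Suc (2 * i))")
    case True
    then show ?thesis
      using U by (intro exI[of _ U]) auto
  next
    case False
    then have "grows (shape U) (s (2 * i))"
      using s \<open>i < N\<close> U by (auto simp: oscillating_def)
    then obtain T where T: "appends (N - i) U T" "shape T = s (2 * i)"
      using appends_grow by blast
    moreover have "is_tableau T"
      using T U part by (intro is_tableau_appends[OF T(1)]) auto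
    moreover have "entries T \<subseteq> {1..N - i}"
      using entries_appends[OF T(1)] U(3) \<open>i < N\<close> by auto
    ultimately show ?thesis by blast
  qed
  then show ?thesis
    using U a unfolding back_step_def by blast
qed

lemma back_run_exists:
  assumes "oscillating N s" "m \<le> N"
  shows "\<exists>T a. is_tableau (T (2 * m)) \<and> shape (T (2 * m)) = s (2 * m) \<and>
    entries (T (2 * m)) \<subseteq> {1..N - m} \<and> T (2 * N) = [] \<and>
    (\<forall>i. m \<le> i \<longrightarrow> i < N \<longrightarrow> back_step N s i (T (2 * i)) (T (Suc (2 * i))) (a i) (T (2 * Suc i)))"
  using assms(2)
proof (induction rule: inc_induct)
  case base
  show ?case
    using assms(1) by (intro exI[of _ "\<lambda>_. []"]) (simp add: oscillating_def shape_def)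
next
  case (step m)
  then obtain T a where V: "is_tableau (T (2 * Suc m))" "shape (T (2 * Suc m)) = s (2 * Suc m)"
      "entries (T (2 * Suc m)) \<subseteq> {1..N - Suc m}" and last: "T (2 * N) = []"
      and steps: "\<And>i. Suc m \<le> i \<Longrightarrow> i < N \<Longrightarrow>
        back_step N s i (T (2 * i)) (T (Suc (2 * i))) (a i) (T (2 * Suc i))"
    by blast
  obtain T0 U0 a0 where new: "back_step N s m T0 U0 a0 (T (2 * Suc m))"
    using back_step_exists[OF assms(1) step(2) V] by blast
  \<comment> \<open>Only the two positions in front of \<open>2 * Suc m\<close> are overwritten, so
    the steps already built stay valid.\<close>
  define T' where "T' = T(2 * m := T0, Suc (2 * m) := U0)"
  have "T' (2 * i) = (if i = m then T0 else T (2 * i))"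
    "T' (Suc (2 * i)) = (if i = m then U0 else T (Suc (2 * i)))" for i
    by (auto simp: T'_def)
  note T' = this this(1)[of "Suc _"]
  have "back_step N s i (T' (2 * i)) (T' (Suc (2 * i))) ((a(m := a0)) i) (T' (2 * Suc i))"
    if "m \<le> i" "i < N" for i
    using that steps[of i] new unfolding T' by auto
  moreover have "is_tableau (T' (2 * m))" "shape (T' (2 * m)) = s (2 * m)"
    "entries (T' (2 * m)) \<subseteq> {1..N - m}"
    using new unfolding T' by (simp_all add: back_step_def)
  moreover have "T' (2 * N) = []"
    using last step(2) unfolding T' by simp
  ultimately show ?case by blast
qed

text \<open>Backwards in time, entry \<open>N - i\<close> enters between positions \<open>i + 1/2\<close> and \<open>i\<close>, hence marks
  the right endpoint \<open>i + 1\<close> of an arc, and it is bumped out at the left endpoint.\<close>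

lemma run_exists:
  assumes "oscillating N s"
  shows "\<exists>E T. arc_run N E T \<and> (\<forall>n \<le> 2 * N. shape (T n) = s n)"
proof -
  obtain T a where T0: "shape (T 0) = s 0" and TN: "T (2 * N) = []"
    and steps: "\<And>i. i < N \<Longrightarrow>
      back_step N s i (T (2 * i)) (T (Suc (2 * i))) (a i) (T (2 * Suc i))"
    using back_run_exists[OF assms, of 0] by auto
  have T0: "T 0 = []"
    using T0 assms by (simp add: oscillating_def shape_def)
  have even: "is_tableau (T (2 * i))" "shape (T (2 * i)) = s (2 * i)" "entries (T (2 * i)) \<subseteq> {1..N - i}"
    and odd: "is_tableau (T (Suc (2 * i)))" "shape (T (Suc (2 * i))) = s (Suc (2 * i))"
      "entries (T (Suc (2 * i))) \<subseteq> {1..<N - i}"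
    and del: "T (2 * i) = T (Suc (2 * i)) \<or> appends (N - i) (T (Suc (2 * i))) (T (2 * i))"
    if "i < N" for i
    using steps[OF that] by (simp_all add: back_step_def)
  have none: "T (2 * Suc i) = T (Suc (2 * i))" if "i < N" "a i = None" for i
    using steps[OF that(1)] that(2) by (simp add: back_step_def)
  have some: "x \<notin> entries (T (Suc (2 * i)))" "T (2 * Suc i) = row_insert x (T (Suc (2 * i)))"
      "entries (T (2 * Suc i)) = insert x (entries (T (Suc (2 * i))))"
    if "i < N" "a i = Some x" for i x
    using steps[OF that(1)] that(2) by (auto simp: back_step_def entries_row_insert)
  have even': "entries (T (2 * i)) \<subseteq> {1..N - i}" if "i \<le> N" for i
    using even(3)[of i] that TN by (cases "i = N") auto
  have x_bounds: "1 \<le> x \<and> x < N - i" if "i < N" "a i = Some x" for i x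
    using some(3)[OF that] even'[of "Suc i"] that(1) by auto
  have del': "entries (T (2 * i)) \<subseteq> insert (N - i) (entries (T (Suc (2 * i))))" if "i < N" for i
    using del[OF that] by (auto dest: entries_appends)
  have ins': "entries (T (Suc (2 * i))) \<subseteq> entries (T (2 * Suc i))" if "i < N" for i
    using none[OF that] some(3)[OF that] by (cases "a i") auto
  \<comment> \<open>An inserted \<open>x\<close> survives up to position \<open>2 * (N - x)\<close>:
    the deletion after position \<open>2 * k\<close> can remove only \<open>N - k\<close>, and an
    insertion removes nothing.\<close>
  have persist: "x \<in> entries (T (2 * k))" if "i < N" "a i = Some x" "Suc i \<le> k" "k \<le> N - x" for i x k
    using that(3,4)
  proof (induction k rule: dec_induct)
    case base
    then show ?case
      using some(3)[OF that(1,2)] by simp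
  next
    case (step k)
    have "k < N" "x \<noteq> N - k"
      using step x_bounds[OF that(1,2)] by auto
    then show ?case
      using step del'[of k] ins'[of k] by auto
  qed
  \<comment> \<open>The run starts empty and, read forwards, only insertions bring in
    entries.\<close>
  have source: "\<exists>i < k. a i = Some x" if "k \<le> N" "x \<in> entries (T (2 * k))" for k x
    using that
  proof (induction k)
    case 0
    then show ?case by (simp add: T0)
  next
    case (Suc k)
    have "entries (T (Suc (2 * k))) \<subseteq> entries (T (2 * k))"
      using del[of k] entries_appends Suc.prems(1) by auto
    then show ?case
      using Suc none[of k] some(3)[of k] by (cases "a k") (auto simp: less_Suc_eq)
  qed
  \<comment> \<open>\<open>x\<close> is inserted at vertex \<open>Suc i\<close>; as a label it
    belongs to the right endpoint \<open>Suc N - x\<close>.\<close>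
  define E where "E = {(Suc i, Suc N - x) | i x. i < N \<and> a i = Some x}"
  have mem_E: "(Suc i, j) \<in> E \<longleftrightarrow> i < N \<and> j \<le> N \<and> a i = Some (Suc N - j)" for i j
    using x_bounds by (fastforce simp: E_def)
  have inj: "i = i'" if "i < N" "i' < N" "a i = Some x" "a i' = Some x" for i i' x
  proof -
    \<comment> \<open>By \<open>persist\<close>, a label inserted at \<open>i\<close> would still be
      present at its second insertion, against freshness; \<open>x < N - i'\<close> keeps it from
      being deleted just before.\<close>
    have False if "i < i'" "i < N" "i' < N" "a i = Some x" "a i' = Some x" for i i'
    proof -
      have "x \<in> entries (T (2 * i'))" "x \<noteq> N - i'"
        using persist[of i x i'] x_bounds[of i' x] that by auto
      then have "x \<in> entries (T (Suc (2 * i')))"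
        using del'[of i'] that by auto
      then show False
        using some(1) that by blast
    qed
    then show ?thesis
      using that by (metis linorder_neqE_nat)
  qed
  have "E \<in> arc_diagrams N"
  proof -
    have "E \<subseteq> {1..N} \<times> {1..N}" "\<forall>(i, j) \<in> E. i < j"
      using x_bounds by (fastforce simp: E_def)+
    moreover have "single_valued E"
      by (auto simp: E_def single_valued_def)
    moreover have "single_valued (E\<inverse>)"
    proof (rule single_valuedI)
      fix i i' j assume ij: "(j, i) \<in> E\<inverse>" "(j, i') \<in> E\<inverse>"
      then obtain i0 i1 where "i = Suc i0" "i' = Suc i1"
        by (auto simp: E_def)
      then show "i = i'"
        using ij inj[of i0 i1] by (simp add: mem_E)
    qed
    ultimately show ?thesis
      by (simp add: arc_diagrams_def)
  qed
  moreover have "T (Suc (2 * i)) =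
      (if Suc i \<in> Range E then jdt_delete (N - i) (T (2 * i)) else T (2 * i))" if i: "i < N" for i
  proof -
    \<comment> \<open>A label persists from its left endpoint until its deletion; conversely, the
      source of the entry \<open>N - i\<close> supplies the left endpoint of an arc ending at
      \<open>Suc i\<close>.\<close>
    have range: "Suc i \<in> Range E \<longleftrightarrow> N - i \<in> entries (T (2 * i))"
    proof
      assume "Suc i \<in> Range E"
      then obtain i' where i': "i' < N" "a i' = Some (N - i)"
        using x_bounds by (fastforce simp: E_def)
      then show "N - i \<in> entries (T (2 * i))"
        using persist[OF i', of i] x_bounds[OF i'] that by auto
    next
      assume "N - i \<in> entries (T (2 * i))"
      then obtain i' where "i' < i" "a i' = Some (N - i)"
        using source[of i] i by auto
      then have "(Suc i', Suc i) \<in> E"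
        using that by (simp add: mem_E)
      then show "Suc i \<in> Range E" by blast
    qed
    show ?thesis
    proof (cases "T (2 * i) = T (Suc (2 * i))")
      case True
      then have "N - i \<notin> entries (T (2 * i))"
        using odd(3)[OF that] by auto
      then show ?thesis
        using True range by simp
    next
      case False
      then have app: "appends (N - i) (T (Suc (2 * i))) (T (2 * i))"
        using del that by blast
      then have "Suc i \<in> Range E"
        using range entries_appends by blast
      moreover have "jdt_delete (N - i) (T (2 * i)) = T (Suc (2 * i))"
        using even[OF that] odd[OF that] by (intro jdt_delete_appends[OF app]) auto
      ultimately show ?thesis
        by simp
    qed
  qed
  moreover have "T (Suc (Suc (2 * i))) = row_insert (Suc N - j) (T (Suc (2 * i)))"
    if "i < N" "(Suc i, j) \<in> E" for i j
    using some(2)[of i "Suc N - j"] that by (simp add: mem_E)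
  moreover have "T (Suc (Suc (2 * i))) = T (Suc (2 * i))" if "i < N" "Suc i \<notin> Domain E" for i
  proof -
    have "a i = None"
      using that by (cases "a i") (auto simp: E_def)
    then show ?thesis
      using none that by simp
  qed
  ultimately have "arc_run N E T"
    using T0 by (intro arc_run.intro) auto
  moreover have "shape (T n) = s n" if "n \<le> 2 * N" for n
  proof (cases "n = 2 * N")
    case True
    then show ?thesis
      using TN assms by (simp add: oscillating_def shape_def)
  next
    case False
    then have "n div 2 < N"
      using that by simp
    then show ?thesis
      using even(2)[of "n div 2"] odd(2)[of "n div 2"] by (cases "even n") auto
  qed
  ultimately show ?thesis by blast
qed

section \<open>The bijection\<close>

lemma left_label_Some:
  assumes "single_valued (edges (std_rep k d))" "(i, j) \<in> edges (std_rep k d)"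
  shows "left_label k d i = Some (Suc (2 * k) - j)"
proof -
  have "(THE e. e \<in> edges (std_rep k d) \<and> fst e = i) = (i, j)"
    using assms by (intro the_equality) (auto dest: single_valuedD)
  then show ?thesis
    using assms(2) by (force simp: left_label_def edge_label_def)
qed

lemma left_label_None:
  assumes "i \<notin> Domain (edges (std_rep k d))"
  shows "left_label k d i = None"
  using assms by (auto simp: left_label_def)

lemma right_label_eq:
  assumes "single_valued ((edges (std_rep k d))\<inverse>)"
  shows "right_label k d j =
    (if j \<in> Range (edges (std_rep k d)) then Some (Suc (2 * k) - j) else None)"
proof (cases "j \<in> Range (edges (std_rep k d))")
  case True
  then obtain i where ij: "(i, j) \<in> edges (std_rep k d)" by blast
  then have "(THE e. e \<in> edges (std_rep k d) \<and> snd e = j) = (i, j)"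
    using assms by (intro the_equality) (auto simp: single_valued_def)
  then show ?thesis
    using ij True by (force simp: right_label_def edge_label_def)
next
  case False
  then show ?thesis
    by (auto simp: right_label_def)
qed

lemma arc_run_insertion:
  assumes "edges (std_rep k d) \<in> arc_diagrams (2 * k)"
  shows "arc_run (2 * k) (edges (std_rep k d)) (insertion_tableau k d)"
proof -
  have sv: "single_valued (edges (std_rep k d))" "single_valued ((edges (std_rep k d))\<inverse>)"
    using assms by (auto simp: arc_diagrams_def)
  have even: "insertion_seq k d (Suc (Suc (2 * i))) = left_label k d (Suc i)"
    and odd: "insertion_seq k d (Suc (2 * i)) = right_label k d (Suc i)" for i
    by (simp_all add: insertion_seq_def)
  show ?thesis
  proof
    show "edges (std_rep k d) \<in> arc_diagrams (2 * k)" by fact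
  qed (simp_all add: even odd right_label_eq[OF sv(2)] left_label_Some[OF sv(1)] left_label_None)
qed

lemma bij_betw_arcs: "bij_betw (\<lambda>d. edges (std_rep k d)) (A k) (arc_diagrams (2 * k))"
  using bij_betw_trans[OF bij_betw_std_rep bij_betw_edges] by (simp add: comp_def)

lemma grows_iff_adds_box:
  assumes "is_int_partition \<mu>" "is_int_partition \<nu>"
  shows "grows \<mu> \<nu> \<longleftrightarrow> adds_box \<mu> \<nu>"
  using assms grows_imp_adds_box adds_box_imp_grows by (auto simp: is_int_partition_def)

text \<open>Replaces the list by a function and \<open>adds_box\<close> by \<open>grows\<close>, so
  that each half of a shape sequence can be compared with \<open>oscillating\<close>.\<close>

lemma VT_iff:
  assumes "length v = 2 * k + 1" "\<And>n. n \<le> 2 * k \<Longrightarrow> v ! n = s n"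
  shows "v \<in> VT k \<mu> \<longleftrightarrow> s 0 = [] \<and> s (2 * k) = \<mu> \<and> (\<forall>n \<le> 2 * k. is_int_partition (s n)) \<and>
    (\<forall>i < k. (s (Suc (2 * i)) = s (2 * i) \<or> grows (s (Suc (2 * i))) (s (2 * i))) \<and>
       (s (2 * Suc i) = s (Suc (2 * i)) \<or> grows (s (Suc (2 * i))) (s (2 * Suc i))))"
proof -
  have "(\<forall>\<nu> \<in> set v. is_int_partition \<nu>) \<longleftrightarrow> (\<forall>n \<le> 2 * k. is_int_partition (s n))"
    using assms by (auto simp: all_set_conv_all_nth less_Suc_eq_le)
  then show ?thesis
    using assms grows_iff_adds_box unfolding VT_def by auto
qed

text \<open>In each double step the middle partition equals each of its neighbours or has one box
  less, a condition invariant under time reversal. So the second half read backwards obeys the same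
  rule as the first, and the halves share only the shape at \<open>2 * k\<close>.\<close>

lemma oscillating_iff_VT_pair:
  assumes "length p = 2 * k + 1" "length q = 2 * k + 1"
    and q: "\<And>n. n \<le> 2 * k \<Longrightarrow> q ! n = s n"
    and p: "\<And>n. n \<le> 2 * k \<Longrightarrow> p ! n = s (4 * k - n)"
  shows "oscillating (2 * k) s \<longleftrightarrow> q \<in> VT k (s (2 * k)) \<and> p \<in> VT k (s (2 * k))" (is "?L \<longleftrightarrow> ?R")
proof -
  let ?t = "\<lambda>n. s (4 * k - n)"
  let ?step = "\<lambda>s i. (s (Suc (2 * i)) = s (2 * i) \<or> grows (s (Suc (2 * i))) (s (2 * i))) \<and>
    (s (2 * Suc i) = s (Suc (2 * i)) \<or> grows (s (Suc (2 * i))) (s (2 * Suc i)))"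
  \<comment> \<open>Double step \<open>i\<close> of the reversed sequence is double step
    \<open>2 * k - Suc i\<close> of \<open>s\<close> with its ends exchanged, so the two conjuncts
    swap.\<close>
  have flip: "?step ?t i \<longleftrightarrow> ?step s (2 * k - Suc i)" if "i < k" for i
  proof -
    have "4 * k - Suc (2 * i) = Suc (2 * (2 * k - Suc i))" "4 * k - 2 * i = 2 * Suc (2 * k - Suc i)"
      "4 * k - 2 * Suc i = 2 * (2 * k - Suc i)"
      using that by auto
    then show ?thesis
      by auto
  qed
  have steps: "(\<forall>i < 2 * k. ?step s i) \<longleftrightarrow> (\<forall>i < k. ?step s i) \<and> (\<forall>i < k. ?step ?t i)"
  proof
    assume *: "\<forall>i < 2 * k. ?step s i"
    have "?step ?t i" if "i < k" for i
      using flip[OF that] spec[OF *, of "2 * k - Suc i"] that by simp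
    then show "(\<forall>i < k. ?step s i) \<and> (\<forall>i < k. ?step ?t i)"
      using * by simp
  next
    assume *: "(\<forall>i < k. ?step s i) \<and> (\<forall>i < k. ?step ?t i)"
    show "\<forall>i < 2 * k. ?step s i"
    proof (intro allI impI)
      fix i assume "i < 2 * k"
      show "?step s i"
      proof (cases "i < k")
        case False
        then have "2 * k - Suc i < k" "2 * k - Suc (2 * k - Suc i) = i"
          using \<open>i < 2 * k\<close> by auto
        then show ?thesis
          using * flip[of "2 * k - Suc i"] by presburger
      qed (use * in blast)
    qed
  qed
  have part: "(\<forall>n \<le> 2 * (2 * k). P (s n)) \<longleftrightarrow> (\<forall>n \<le> 2 * k. P (s n)) \<and> (\<forall>n \<le> 2 * k. P (?t n))" for P
  proof (intro iffI conjI allI impI)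
    fix n assume *: "(\<forall>n \<le> 2 * k. P (s n)) \<and> (\<forall>n \<le> 2 * k. P (?t n))" and "n \<le> 2 * (2 * k)"
    then show "P (s n)"
      using spec[OF conjunct2[OF *], of "4 * k - n"] by (cases "n \<le> 2 * k") auto
  qed auto
  have mid: "4 * k - 2 * k = 2 * k" "2 * (2 * k) = 4 * k"
    by auto
  have "q \<in> VT k \<mu> \<longleftrightarrow> s 0 = [] \<and> s (2 * k) = \<mu> \<and>
      (\<forall>n \<le> 2 * k. is_int_partition (s n)) \<and> (\<forall>i < k. ?step s i)" for \<mu>
    by (rule VT_iff[OF assms(2) q])
  moreover have "p \<in> VT k \<mu> \<longleftrightarrow> ?t 0 = [] \<and> ?t (2 * k) = \<mu> \<and>
      (\<forall>n \<le> 2 * k. is_int_partition (?t n)) \<and> (\<forall>i < k. ?step ?t i)" for \<mu>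
    by (rule VT_iff[OF assms(1) p])
  ultimately show ?thesis
    unfolding oscillating_def steps part unfolding mid by auto
qed

lemma nth_Q_tab: "n \<le> 2 * k \<Longrightarrow> Q_tab k d ! n = insertion_shape k d n"
  by (simp add: Q_tab_def del: upt_Suc)

lemma nth_P_tab: "n \<le> 2 * k \<Longrightarrow> P_tab k d ! n = insertion_shape k d (4 * k - n)"
  by (simp add: P_tab_def rev_nth del: upt_Suc)

lemma finite_Gamma: "finite (Gamma k)"
proof (rule finite_subset)
  show "Gamma k \<subseteq> {\<mu>. set \<mu> \<subseteq> {..k} \<and> length \<mu> \<le> k}"
  proof
    fix \<mu> assume \<mu>: "\<mu> \<in> Gamma k"
    have "x \<le> k" if "x \<in> set \<mu>" for x
      using member_le_sum_list[OF that] \<mu> by (simp add: Gamma_def)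
    moreover have "length \<mu> \<le> sum_list \<mu>" if "0 \<notin> set \<mu>"
      using that by (induction \<mu>) auto
    ultimately show "\<mu> \<in> {\<mu>. set \<mu> \<subseteq> {..k} \<and> length \<mu> \<le> k}"
      using \<mu> by (auto simp: Gamma_def is_int_partition_def)
  qed
  show "finite {\<mu>. set \<mu> \<subseteq> {..k} \<and> length \<mu> \<le> k}"
    by (rule finite_lists_length_le) simp
qed

lemma bij_betw_insertion_map:
  "bij_betw (insertion_map k) (A k) (SIGMA \<mu>:Gamma k. VT k \<mu> \<times> VT k \<mu>)"
proof (rule bij_betw_imageI)
  have run: "arc_run (2 * k) (edges (std_rep k d)) (insertion_tableau k d)" if "d \<in> A k" for d
    using bij_betwE[OF bij_betw_arcs] that by (intro arc_run_insertion) simp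
  have len: "length (P_tab k d) = 2 * k + 1" "length (Q_tab k d) = 2 * k + 1" for d
    by (simp_all add: P_tab_def Q_tab_def)
  show "inj_on (insertion_map k) (A k)"
  proof (rule inj_onI)
    fix d d' assume d: "d \<in> A k" "d' \<in> A k" and eq: "insertion_map k d = insertion_map k d'"
    have "insertion_shape k d n = insertion_shape k d' n" if "n \<le> 4 * k" for n
    proof (cases "n \<le> 2 * k")
      case True
      then show ?thesis
        using eq nth_Q_tab[of n k d] nth_Q_tab[of n k d'] by (simp add: insertion_map_def)
    next
      case False
      then show ?thesis
        using eq that nth_P_tab[of "4 * k - n" k d] nth_P_tab[of "4 * k - n" k d']
        by (simp add: insertion_map_def)
    qed
    then have "edges (std_rep k d) = edges (std_rep k d')"
      using arcs_determined_by_shapes[OF run[OF d(1)] run[OF d(2)]]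
      by (simp add: insertion_shape_def)
    then show "d = d'"
      using inj_onD[OF bij_betw_imp_inj_on[OF bij_betw_arcs[of k]]] d by simp
  qed
  show "insertion_map k ` A k = (SIGMA \<mu>:Gamma k. VT k \<mu> \<times> VT k \<mu>)"
  proof (intro equalityI subsetI)
    fix z assume "z \<in> insertion_map k ` A k"
    then obtain d where d: "d \<in> A k" and z: "z = insertion_map k d" by blast
    have osc: "oscillating (2 * k) (insertion_shape k d)"
      using oscillating_run[OF run[OF d]] by (simp add: insertion_shape_def [abs_def])
    then have "is_int_partition (insertion_shape k d (2 * k))"
      by (simp add: oscillating_def)
    moreover have "Q_tab k d \<in> VT k (insertion_shape k d (2 * k))"
      "P_tab k d \<in> VT k (insertion_shape k d (2 * k))"
      using oscillating_iff_VT_pair[OF len(1,2) nth_Q_tab nth_P_tab, of d] osc by simp_all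
    moreover have "sum_list (insertion_shape k d (2 * k)) \<le> k"
      using arc_run.sum_list_shape_even[OF run[OF d], of k] by (simp add: insertion_shape_def)
    ultimately show "z \<in> (SIGMA \<mu>:Gamma k. VT k \<mu> \<times> VT k \<mu>)"
      by (simp add: z insertion_map_def Gamma_def)
  next
    fix z assume "z \<in> (SIGMA \<mu>:Gamma k. VT k \<mu> \<times> VT k \<mu>)"
    then obtain \<mu> p q where z: "z = (\<mu>, p, q)" and pq: "p \<in> VT k \<mu>" "q \<in> VT k \<mu>"
      by auto
    \<comment> \<open>The halves are glued at \<open>2 * k\<close>, where both \<open>q\<close> and
      \<open>p\<close> have the value \<open>\<mu>\<close>; beyond that point \<open>p\<close> is
      read backwards.\<close>
    define s where "s n = (if n \<le> 2 * k then q ! n else p ! (4 * k - n))" for n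
    have lens: "length p = 2 * k + 1" "length q = 2 * k + 1" and ends: "q ! (2 * k) = \<mu>" "p ! (2 * k) = \<mu>"
      using pq by (auto simp: VT_def)
    have q: "q ! n = s n" if "n \<le> 2 * k" for n
      using that by (simp add: s_def)
    have p: "p ! n = s (4 * k - n)" if "n \<le> 2 * k" for n
    proof (cases "n = 2 * k")
      case True
      then show ?thesis
        using ends by (simp add: s_def)
    next
      case False
      then have "\<not> 4 * k - n \<le> 2 * k" "4 * k - (4 * k - n) = n"
        using that by auto
      then show ?thesis
        by (simp add: s_def)
    qed
    have mid: "s (2 * k) = \<mu>"
      using ends by (simp add: s_def)
    then have "oscillating (2 * k) s"
      using oscillating_iff_VT_pair[OF lens q p] pq by simp
    then obtain E T where T: "arc_run (2 * k) E T" "\<forall>n \<le> 2 * (2 * k). shape (T n) = s n"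
      using run_exists by blast
    \<comment> \<open>\<open>E\<close> is known only as an arc diagram; \<open>bij_betw_arcs\<close>
      turns it into a set partition, whose run must then agree with \<open>T\<close>.\<close>
    have "E \<in> (\<lambda>d. edges (std_rep k d)) ` A k"
      using bij_betw_imp_surj_on[OF bij_betw_arcs[of k]] arc_run.arcs[OF T(1)] by simp
    then obtain d where d: "d \<in> A k" "edges (std_rep k d) = E"
      by (elim imageE) simp
    have shape: "insertion_shape k d n = s n" if "n \<le> 4 * k" for n
      using arc_run_unique[OF run[OF d(1)], of T n] T d(2) that by (simp add: insertion_shape_def)
    have "Q_tab k d = q"
      using len lens by (intro nth_equalityI) (simp_all add: nth_Q_tab shape q)
    moreover have "P_tab k d = p"
      using len lens by (intro nth_equalityI) (simp_all add: nth_P_tab shape p)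
    ultimately have "insertion_map k d = z"
      using shape[of "2 * k"] mid by (simp add: insertion_map_def z)
    then show "z \<in> insertion_map k ` A k"
      using d(1) by blast
  qed
qed

lemma card_A: "card (A k) = bell (2 * k)"
  using bij_betw_same_card[OF bij_betw_std_rep] by (simp add: bell_def)

lemma finite_A: "finite (A k)"
  by (simp add: A_def finite_set_partitions)

theorem theorem4p4:
  fixes k :: nat
  assumes "k \<ge> 1"
  shows "bij_betw (insertion_map k) (A k) (SIGMA \<mu>:Gamma k. VT k \<mu> \<times> VT k \<mu>) \<and>
         bell (2 * k) = (\<Sum>\<mu> \<in> Gamma k. (card (VT k \<mu>))\<^sup>2)"
proof
  let ?S = "SIGMA \<mu>:Gamma k. VT k \<mu> \<times> VT k \<mu>"
  show bij: "bij_betw (insertion_map k) (A k) ?S"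
    by (rule bij_betw_insertion_map)
  \<comment> \<open>Finiteness of every \<open>VT k \<mu>\<close> is inherited from
    \<open>A k\<close> through the bijection.\<close>
  have "finite ?S"
    using bij_betw_finite[OF bij] finite_A by simp
  then have "finite (VT k \<mu> \<times> VT k \<mu>)" if "\<mu> \<in> Gamma k" for \<mu>
    using that by (rule_tac finite_subset[of _ "snd ` ?S"]) (force, simp)
  then have "card ?S = (\<Sum>\<mu> \<in> Gamma k. card (VT k \<mu> \<times> VT k \<mu>))"
    using finite_Gamma by (intro card_SigmaI) auto
  then show "bell (2 * k) = (\<Sum>\<mu> \<in> Gamma k. (card (VT k \<mu>))\<^sup>2)"
    using bij_betw_same_card[OF bij] by (simp add: card_A card_cartesian_product power2_eq_square)
qed

end
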